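(* Let $\lambda>2$ be an arbitrary real number. For each integer $N\ge1$ define $$A_N(\lambda)=\{n\in\mathbb{Z}:|n|\le N-1\}\cup\{n\in\mathbb{Z}:|n-N\lambda|\le N-1\}\cup\{n\in\mathbb{Z}:|n+N\lambda|\le N-1\}.$$ Then $$\mathcal{T}_{\mathbb{R}}(\Omega_\lambda)=\lim_{N\to\infty}\frac1N\,\mathcal{T}_{\mathbb{Z}}(A_N(\lambda)).$$
   Context: For $\lambda\ge 0$ let $\Omega_\lambda=(-1,1)\cup(\lambda-1,\lambda+1)\cup(-\lambda-1,-\lambda+1)\subset\mathbb{R}$. A function $f:\mathbb{R}\to\mathbb{C}$ is positive definite if $\sum_{j,k=1}^m z_j\overline{z_k}f(x_j-x_k)\ge 0$ for all finite choices of $x_1,\dots,x_m\in\mathbb{R}$ and $z_1,\dots,z_m\in\mathbb{C}$. For an open bounded set $\Omega\subset\mathbb{R}$ with $\Omega=-\Omega$ and $0\in\Omega$, the Turán constant is $$\mathcal{T}_{\mathbb{R}}(\Omega)=\sup\left\{\int_{\mathbb{R}}f(x)\,dx: f\in C(\mathbb{R}),\ f \text{ positive definite},\ f(0)=1,\ \operatorname{supp} f\subset\Omega\right\},$$ where $\operatorname{supp} f$ is the closed support of $f$ (the integrals in question are automatically real). A complex sequence $(c_n)_{n\in\mathbb{Z}}$ is positive definite if $\sum_{j,k=1}^r z_j\overline{z_k}c_{m_j-m_k}\ge0$ for every finite set $\{m_1,\dots,m_r\}\subset\mathbb{Z}$ and all $z_1,\dots,z_r\in\mathbb{C}$. For a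 finite set $A\subset\mathbb{Z}$ with $A=-A$ and $0\in A$, the discrete Turán constant is $$\mathcal{T}_{\mathbb{Z}}(A)=\sup\left\{\sum_{n\in A}c_n:(c_n)_{n\in\mathbb{Z}}\text{ positive definite},\ c_0=1,\ c_n=0\text{ for }n\notin A\right\}$$ (the sums in question are automatically real). *)

theory Defs
  imports "HOL-Analysis.Analysis"
begin

text \<open>The set \<open>\<real>\<^sub>\<ge>\<^sub>0\<close> is \<^const>\<open>nonneg_Reals\<close>; membership of a complex number in it says that
  the number is real and nonnegative.\<close>

definition positive_definite_real :: "(real \<Rightarrow> complex) \<Rightarrow> bool" where
  "positive_definite_real f \<longleftrightarrow>
    (\<forall>(m::nat) (x::nat \<Rightarrow> real) (z::nat \<Rightarrow> complex).
      (\<Sum>j<m. \<Sum>k<m. z j * cnj (z k) * f (x j - x k)) \<in> \<real>\<^sub>\<ge>\<^sub>0)"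

definition positive_definite_int :: "(int \<Rightarrow> complex) \<Rightarrow> bool" where
  "positive_definite_int c \<longleftrightarrow>
    (\<forall>(F::int set) (z::int \<Rightarrow> complex). finite F \<longrightarrow>
      (\<Sum>j\<in>F. \<Sum>k\<in>F. z j * cnj (z k) * c (j - k)) \<in> \<real>\<^sub>\<ge>\<^sub>0)"

definition closed_support :: "(real \<Rightarrow> complex) \<Rightarrow> real set" where
  "closed_support f = closure {x. f x \<noteq> 0}"

text \<open>The two Turan constants are suprema in \<^typ>\<open>real\<close>. They are meaningful for
  \<open>\<Omega>\<close> open, bounded, symmetric and containing \<open>0\<close>, respectively for \<open>A\<close> finite, symmetric and
  containing \<open>0\<close>: then the sets below are nonempty and bounded above (positive definiteness gives
  \<open>\<bar>f x\<bar> \<le> f 0 = 1\<close>). By Hermitian symmetry of positive definite functions, the integral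
  and the sum are real, so \<^const>\<open>Re\<close> only changes the type.\<close>

definition turan_real :: "real set \<Rightarrow> real" where
  "turan_real \<Omega> = Sup {Re (LINT x|lborel. f x) | f.
     continuous_on UNIV f \<and> positive_definite_real f \<and> f 0 = 1 \<and> closed_support f \<subseteq> \<Omega>}"

definition turan_int :: "int set \<Rightarrow> real" where
  "turan_int A = Sup {Re (\<Sum>n\<in>A. c n) | c.
     positive_definite_int c \<and> c 0 = 1 \<and> (\<forall>n. n \<notin> A \<longrightarrow> c n = 0)}"

definition Omega :: "real \<Rightarrow> real set" where
  "Omega lam = {-1<..<1} \<union> {lam - 1<..<lam + 1} \<union> {-lam - 1<..<-lam + 1}"

definition A_set :: "nat \<Rightarrow> real \<Rightarrow> int set" where
  "A_set N lam =
     {n. \<bar>n\<bar> \<le> int N - 1}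
   \<union> {n. \<bar>real_of_int n - real N * lam\<bar> \<le> real N - 1}
   \<union> {n. \<bar>real_of_int n + real N * lam\<bar> \<le> real N - 1}"

end

theory Submission
  imports Defs
begin

text \<open>Why the theorem holds.  Write \<open>T\<close> for the continuous Turan constant, and call the trigonometric
  polynomial \<open>p(z) = \<Sum>n. c n z^n\<close> on the unit circle the symbol of a finitely supported sequence \<open>c\<close>.
  Such a sequence is positive definite iff its symbol is nonnegative (\<open>symbol_nonneg\<close>,
  \<open>pd_int_of_symbol\<close>); \<open>c 0\<close> is the mean of \<open>p\<close> and the sum of \<open>c\<close> is \<open>p(1)\<close>.

  Lower bound.  Sampling an admissible \<open>f\<close> at the points \<open>n / N\<close> gives a positive definite sequence,
  supported in \<open>A_set N lam\<close> for large \<open>N\<close> since the compact support of \<open>f\<close> keeps a margin from the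
  boundary of the open set; the sums divided by \<open>N\<close> are Riemann sums of the integral
  (\<open>turan_int_above_integral\<close>).

  Upper bound.  Conversely, interpolating a positive definite \<open>c\<close> piecewise linearly yields a positive
  definite function (\<open>pd_real_interp\<close>), but for \<open>c\<close> supported in \<open>A_set N lam\<close> its closed support
  may touch the boundary of \<open>Omega lam\<close>.  Rescaling alone does not help: shrinking the function by a
  factor moves the outer blocks away from \<open>\<plusminus>lam\<close>.  Therefore the outer blocks of \<open>c\<close> are first
  translated away from the origin by an integer \<open>s\<close>, about \<open>lam L\<close>, which makes room for shrinking by
  \<open>N / (N + s / lam)\<close>.  With \<open>H\<close> the symbol of the right block, the
  translation adds \<open>2 Re ((z^s - 1) H(z))\<close> to \<open>p\<close>.  This error is small near \<open>z = 1\<close>; away from \<open>1\<close> it is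
  damped by multiplication with a normalised Fejer kernel of length \<open>L\<close>, which keeps the value at \<open>1\<close>
  and widens the blocks by less than \<open>L\<close>.  What remains is absorbed by adding a nonnegative
  correction with spectrum in the central block.  Its existence rests on the representation of \<open>H\<close>
  as an average of translates of a fixed kernel \<open>V\<close> (with coefficients \<open>1\<close> on the right block, \<open>0\<close> on
  the others), weighted by the nonnegative values of \<open>p\<close> at roots of unity, and on a nonnegative
  polynomial of degree below \<open>N\<close> that dominates \<open>V\<close> with a factor \<open>1 + N \<bar>z - 1\<bar>\<close> to spare
  (\<open>plateau_bound\<close>, \<open>correction_dominates\<close>).

  The correction costs \<open>c 0\<close> an amount proportional to the average of \<open>window (L \<bar>w - 1\<bar>) + 2 L / N\<close>
  against \<open>p\<close>, where \<open>window\<close> is small unless \<open>L \<bar>w - 1\<bar>\<close> is of order \<open>1\<close>.  Summed over the dyadic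
  lengths \<open>L = 2^j\<close>, \<open>j < J\<close>, these averages stay bounded, so that for one \<open>j\<close> the cost is \<open>O(1 / J)\<close>
  (\<open>exists_good_scale\<close>).  The outcome is an explicit inequality between the two constants
  (\<open>turan_int_le_turan_real\<close>) from which the limit follows by letting first \<open>N\<close> and then \<open>J\<close> tend to infinity.\<close>

section \<open>Positive definite sequences and their symbols\<close>

lemma pd_intD:
  assumes "positive_definite_int c" "finite F"
  shows "(\<Sum>j\<in>F. \<Sum>k\<in>F. z j * cnj (z k) * c (j - k)) \<in> \<real>\<^sub>\<ge>\<^sub>0"
  using assms unfolding positive_definite_int_def by simp

lemma pd_int_diag:
  assumes "positive_definite_int c"
  shows "c 0 \<in> \<real>\<^sub>\<ge>\<^sub>0"
  using pd_intD[OF assms, of "{0}" "\<lambda>_. 1"] by simp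

text \<open>The quadratic form on two points; its special cases give symmetry and the maximum at \<open>0\<close>.\<close>

lemma pd_int_two_points:
  assumes "positive_definite_int c" "n \<noteq> 0"
  shows "(a * cnj a + b * cnj b) * c 0 + a * cnj b * c (- n) + b * cnj a * c n \<in> \<real>\<^sub>\<ge>\<^sub>0"
proof -
  have "(\<Sum>j\<in>{0,n}. \<Sum>k\<in>{0,n}. (if j = 0 then a else b) * cnj (if k = 0 then a else b) * c (j - k))
      = (a * cnj a + b * cnj b) * c 0 + a * cnj b * c (- n) + b * cnj a * c n"
    using assms(2) by (simp add: distrib_right)
  then show ?thesis
    using pd_intD[OF assms(1), of "{0,n}" "\<lambda>j. if j = 0 then a else b"] by simp
qed

lemma pd_int_hermitian:
  assumes "positive_definite_int c"
  shows "c (- n) = cnj (c n)"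
proof (cases "n = 0")
  case True
  then show ?thesis using pd_int_diag[OF assms] by (auto simp: complex_nonneg_Reals_iff complex_eq_iff)
next
  case False
  note two = pd_int_two_points[OF assms False]
  have "Im (c 0) = 0" using pd_int_diag[OF assms] by (simp add: complex_nonneg_Reals_iff)
  moreover have "Im (c (- n)) + Im (c n) = 0"
    using two[of 1 1] calculation by (simp add: complex_nonneg_Reals_iff)
  moreover have "Re (c n) - Re (c (- n)) = 0"
    using two[of 1 \<i>] calculation by (simp add: complex_nonneg_Reals_iff)
  ultimately show ?thesis
    by (simp add: complex_eq_iff)
qed

lemma pd_int_bound:
  assumes "positive_definite_int c"
  shows "norm (c n) \<le> Re (c 0)"
proof (cases "n = 0 \<or> c n = 0")
  case True
  then show ?thesis using nonneg_Reals_cmod_eq_Re[OF pd_int_diag[OF assms]]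
    by (metis norm_ge_zero norm_zero order.refl)
next
  case False
  \<comment> \<open>This unimodular factor makes the two mixed terms add up to \<open>- 2 * norm (c n)\<close>.\<close>
  define b where "b = - cnj (c n) / of_real (norm (c n))"
  have sq: "c n * cnj (c n) = of_real (norm (c n)) * of_real (norm (c n))"
    by (simp only: complex_norm_square [symmetric] of_real_power power2_eq_square of_real_mult)
  have bb: "b * cnj b = 1"
    using False sq by (simp add: b_def field_simps)
  have bc: "b * c n = - of_real (norm (c n))"
    using False sq by (simp add: b_def field_simps)
  have bc': "cnj b * cnj (c n) = - of_real (norm (c n))"
    using arg_cong[OF bc, of cnj] by simp
  show ?thesis
    using pd_int_two_points[OF assms, of n 1 b] False unfolding bb bc
      pd_int_hermitian[OF assms] mult_1 complex_cnj_one mult_1_right bc'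
    by (simp add: complex_nonneg_Reals_iff)
qed

lemma pd_int_add:
  assumes "positive_definite_int c" "positive_definite_int d"
  shows "positive_definite_int (\<lambda>n. c n + d n)"
  unfolding positive_definite_int_def
proof (intro allI impI)
  fix F :: "int set" and z assume "finite F"
  then show "(\<Sum>j\<in>F. \<Sum>k\<in>F. z j * cnj (z k) * (c (j - k) + d (j - k))) \<in> \<real>\<^sub>\<ge>\<^sub>0"
    using nonneg_Reals_add_I[OF pd_intD[OF assms(1)] pd_intD[OF assms(2)], of F F z z]
    by (simp add: distrib_left sum.distrib)
qed

lemma pd_int_scale:
  assumes "positive_definite_int c" "0 \<le> r"
  shows "positive_definite_int (\<lambda>n. of_real r * c n)"
  unfolding positive_definite_int_def
proof (intro allI impI)
  fix F :: "int set" and z assume "finite F"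
  moreover have "(\<Sum>j\<in>F. \<Sum>k\<in>F. z j * cnj (z k) * (of_real r * c (j - k))) =
      of_real r * (\<Sum>j\<in>F. \<Sum>k\<in>F. z j * cnj (z k) * c (j - k))"
    by (simp add: sum_distrib_left mult.left_commute)
  ultimately show "(\<Sum>j\<in>F. \<Sum>k\<in>F. z j * cnj (z k) * (of_real r * c (j - k))) \<in> \<real>\<^sub>\<ge>\<^sub>0"
    using assms(2) nonneg_Reals_mult_I[OF _ pd_intD[OF assms(1)], of "of_real r" F z] by simp
qed

definition impulse :: "int \<Rightarrow> int \<Rightarrow> complex" where
  "impulse m n = (if n = m then 1 else 0)"

lemma pd_int_impulse: "positive_definite_int (impulse 0)"
proof -
  have "(\<Sum>j\<in>F. \<Sum>k\<in>F. z j * cnj (z k) * impulse 0 (j - k)) = (\<Sum>j\<in>F. of_real ((norm (z j))\<^sup>2))"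
    if "finite F" for F :: "int set" and z
    using that by (intro sum.cong) (auto simp: impulse_def if_distrib[of "\<lambda>t. _ * t"] complex_norm_square
      simp del: of_real_power cong: if_cong)
  then show ?thesis unfolding positive_definite_int_def
    by (auto simp flip: of_real_sum intro!: sum_nonneg simp del: of_real_power of_real_sum)
qed

text \<open>The trigonometric polynomial with coefficients \<open>c\<close>.  Summing over the support itself leaves no
  summation range to carry along; for infinite support the value is the default \<open>0\<close>.\<close>

definition symbol :: "(int \<Rightarrow> complex) \<Rightarrow> complex \<Rightarrow> complex" where
  "symbol c z = (\<Sum>n | c n \<noteq> 0. c n * z powi n)"

lemma symbol_eq_sum:
  assumes "finite S" "\<And>n. n \<notin> S \<Longrightarrow> c n = 0"
  shows "symbol c z = (\<Sum>n\<in>S. c n * z powi n)"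
  unfolding symbol_def using assms by (intro sum.mono_neutral_left) auto

lemma finite_support_subset: "finite S \<Longrightarrow> (\<And>n. n \<notin> S \<Longrightarrow> c n = 0) \<Longrightarrow> finite {n. c n \<noteq> (0::complex)}"
  for S :: "int set"
  by (rule finite_subset[of _ S]) auto

lemma finite_support_add: "finite {n. c n \<noteq> 0} \<Longrightarrow> finite {n. d n \<noteq> 0} \<Longrightarrow> finite {n. c n + d n \<noteq> (0::complex)}"
  for c d :: "int \<Rightarrow> complex"
  by (rule finite_subset[of _ "{n. c n \<noteq> 0} \<union> {n. d n \<noteq> 0}"]) auto

lemma finite_support_shift: "finite {n. c n \<noteq> 0} \<Longrightarrow> finite {n. c (n - s) \<noteq> (0::complex)}"
  for c :: "int \<Rightarrow> complex"
  using finite_vimageI[of "{n. c n \<noteq> 0}" "\<lambda>n. n - s"] by (simp add: inj_on_def vimage_def)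

lemma finite_support_mult: "finite {n. c n \<noteq> 0} \<Longrightarrow> finite {n. d n * c n \<noteq> (0::complex)}"
  for c d :: "int \<Rightarrow> complex"
  by (rule finite_subset[of _ "{n. c n \<noteq> 0}"]) auto

lemma finite_support_sum: "finite I \<Longrightarrow> (\<And>i. i \<in> I \<Longrightarrow> finite {n. c i n \<noteq> 0}) \<Longrightarrow> finite {n. (\<Sum>i\<in>I. c i n) \<noteq> (0::complex)}"
  for c :: "'i \<Rightarrow> int \<Rightarrow> complex"
  by (rule finite_subset[of _ "\<Union>i\<in>I. {n. c i n \<noteq> 0}"])
    (use sum.not_neutral_contains_not_neutral in fastforce, blast)

lemma symbol_add:
  assumes "finite {n. c n \<noteq> 0}" "finite {n. d n \<noteq> 0}"
  shows "symbol (\<lambda>n. c n + d n) z = symbol c z + symbol d z"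
proof -
  define S where "S = {n. c n \<noteq> 0} \<union> {n. d n \<noteq> 0}"
  have "finite S" using assms by (simp add: S_def)
  then show ?thesis
    by (subst (1 2 3) symbol_eq_sum[of S]) (auto simp: S_def sum.distrib algebra_simps)
qed

lemma symbol_cmult: "symbol (\<lambda>n. a * c n) z = a * symbol c z"
  by (cases "a = 0") (simp_all add: symbol_def sum_distrib_left mult.assoc)

lemma symbol_sum:
  assumes "finite I" "\<And>i. i \<in> I \<Longrightarrow> finite {n. c i n \<noteq> 0}"
  shows "symbol (\<lambda>n. \<Sum>i\<in>I. c i n) z = (\<Sum>i\<in>I. symbol (c i) z)"
  using assms
proof (induction I rule: finite_induct)
  case empty
  then show ?case by (simp add: symbol_def)
next
  case (insert i I)
  then show ?case by (simp add: symbol_add finite_support_sum)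
qed

lemma symbol_shift:
  assumes "z \<noteq> 0"
  shows "symbol (\<lambda>n. c (n - s)) z = z powi s * symbol c z"
proof -
  have "symbol (\<lambda>n. c (n - s)) z = (\<Sum>n | c n \<noteq> 0. c n * z powi (n + s))"
    unfolding symbol_def
    by (rule sum.reindex_bij_witness[of _ "\<lambda>n. n + s" "\<lambda>n. n - s"]) auto
  with assms show ?thesis by (simp add: symbol_def power_int_add sum_distrib_left algebra_simps)
qed

lemma symbol_modulate:
  assumes "u \<noteq> 0"
  shows "symbol (\<lambda>n. u powi n * c n) z = symbol c (u * z)"
  using assms by (auto simp: symbol_def power_int_mult_distrib mult_ac)

lemma symbol_impulse: "symbol (impulse m) z = z powi m"
  by (subst symbol_eq_sum[of "{m}"]) (auto simp: impulse_def)

lemma finite_support_impulse: "finite {n. impulse m n \<noteq> 0}"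
  by (rule finite_subset[of _ "{m}"]) (auto simp: impulse_def)

lemma cnj_unit: "norm z = 1 \<Longrightarrow> cnj z = inverse z"
  using complex_norm_square[of z] by (simp add: inverse_unique)

lemma cnj_unit_powi: "norm z = 1 \<Longrightarrow> cnj (z powi n) = z powi (- n)"
  by (simp only: complex_cnj_power_int cnj_unit power_int_minus power_int_inverse)

lemma symbol_reflect:
  assumes "norm z = 1"
  shows "symbol (\<lambda>n. cnj (c (- n))) z = cnj (symbol c z)"
  unfolding symbol_def cnj_sum
  by (rule sum.reindex_bij_witness[of _ uminus uminus]) (auto simp: cnj_unit_powi[OF assms] simp del: complex_cnj_power_int)

section \<open>Positive definiteness as nonnegativity of the symbol\<close>

definition unity_root :: "nat \<Rightarrow> nat \<Rightarrow> complex" where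
  "unity_root M k = cis (2 * pi * real k / real M)"

lemma norm_unity_root [simp]: "norm (unity_root M k) = 1"
  by (simp add: unity_root_def)

text \<open>Orthogonality of the characters of a finite cyclic group.\<close>

lemma sum_unity_root_powi:
  assumes "0 < M"
  shows "(\<Sum>k<M. unity_root M k powi n) = (if int M dvd n then of_nat M else 0)"
proof -
  define q where "q = cis (2 * pi * of_int n / of_nat M)"
  have pow: "unity_root M k powi n = q ^ k" for k
  proof -
    have "q ^ k = cis (real k * (2 * pi * of_int n / of_nat M))" unfolding q_def by (rule Complex.DeMoivre)
    then show ?thesis by (simp add: unity_root_def cis_power_int mult_ac)
  qed
  have "q ^ M = cis (2 * pi * of_int n)"
    using assms by (simp add: q_def Complex.DeMoivre)
  then have qM: "q ^ M = 1" by (simp add: cis_multiple_2pi)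
  have q1: "q = 1 \<longleftrightarrow> int M dvd n"
  proof
    assume "int M dvd n"
    then obtain k where "n = int M * k" by blast
    with assms show "q = 1" using cis_multiple_2pi[of "of_int k"] by (simp add: q_def mult_ac)
  next
    assume "q = 1"
    then have "cos (2 * pi * of_int n / of_nat M) = 1" by (simp add: q_def complex_eq_iff)
    then obtain k :: int where "2 * pi * of_int n / of_nat M = of_int k * 2 * pi"
      using cos_one_2pi_int by blast
    then have "of_int n = (of_int k * of_nat M :: real)" using assms by (simp add: field_simps)
    then have "n = k * int M" by (metis of_int_eq_iff of_int_mult of_int_of_nat_eq)
    then show "int M dvd n" by simp
  qed
  show ?thesis
  proof (cases "q = 1")
    case True
    then show ?thesis using q1 by (simp add: pow)
  next
    case False
    then have "(\<Sum>k<M. q ^ k) = 0" using qM by (simp add: geometric_sum)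
    with False q1 show ?thesis by (simp add: pow)
  qed
qed

text \<open>Sampling at the \<open>M\<close>-th roots of unity recovers a coefficient as soon as no other frequency of the
  support is congruent to \<open>n\<close> modulo \<open>M\<close>.\<close>

lemma symbol_inversion:
  assumes "0 < M" "finite {n. c n \<noteq> 0}"
    and "\<And>m. c m \<noteq> 0 \<Longrightarrow> int M dvd m - n \<Longrightarrow> m = n"
  shows "(\<Sum>k<M. symbol c (unity_root M k) * unity_root M k powi (- n)) = of_nat M * c n"
proof -
  define S where "S = insert n {n. c n \<noteq> 0}"
  have S: "finite S" using assms(2) by (simp add: S_def)
  have nz: "unity_root M k \<noteq> 0" for k by (simp add: unity_root_def)
  have "(\<Sum>k<M. symbol c (unity_root M k) * unity_root M k powi (- n))
      = (\<Sum>k<M. \<Sum>m\<in>S. c m * unity_root M k powi (m - n))"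
  proof (rule sum.cong[OF refl])
    fix k
    have "symbol c (unity_root M k) = (\<Sum>m\<in>S. c m * unity_root M k powi m)"
      using S by (intro symbol_eq_sum) (auto simp: S_def)
    then show "symbol c (unity_root M k) * unity_root M k powi (- n) = (\<Sum>m\<in>S. c m * unity_root M k powi (m - n))"
      using power_int_add[of "unity_root M k" _ "- n"] nz[of k] by (simp add: sum_distrib_right mult.assoc)
  qed
  also have "\<dots> = (\<Sum>m\<in>S. c m * (\<Sum>k<M. unity_root M k powi (m - n)))"
    by (subst sum.swap) (simp add: sum_distrib_left)
  also have "\<dots> = (\<Sum>m\<in>S. if m = n then of_nat M * c m else 0)"
    using assms by (intro sum.cong) (auto simp: sum_unity_root_powi)
  also have "\<dots> = of_nat M * c n"
    using S by (simp add: S_def)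
  finally show ?thesis .
qed

lemma nonneg_Reals_sum:
  "(\<And>i. i \<in> I \<Longrightarrow> f i \<in> \<real>\<^sub>\<ge>\<^sub>0) \<Longrightarrow> sum f I \<in> (\<real>\<^sub>\<ge>\<^sub>0 :: complex set)"
  by (induction I rule: infinite_finite_induct) auto

lemma nonneg_Reals_mult_cnj: "z * cnj z \<in> \<real>\<^sub>\<ge>\<^sub>0"
  by (simp add: complex_nonneg_Reals_iff)

text \<open>By discrete Fourier inversion every coefficient that occurs in the quadratic form is an average of
  \<open>symbol c w * w powi (k - j)\<close> over sufficiently many roots of unity \<open>w\<close>.  This turns the form into a
  nonnegative combination of the squares of \<open>\<bar>\<Sum>j. z j * w powi (- j)\<bar>\<close>.\<close>

lemma pd_int_of_symbol:
  assumes fin: "finite {n. c n \<noteq> 0}" and pos: "\<And>z. norm z = 1 \<Longrightarrow> symbol c z \<in> \<real>\<^sub>\<ge>\<^sub>0"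
  shows "positive_definite_int c"
  unfolding positive_definite_int_def
proof (intro allI impI)
  fix F :: "int set" and z assume F: "finite F"
  define R where "R = Max (abs ` (F \<union> {n. c n \<noteq> 0}))"
  have R: "\<forall>n\<in>F \<union> {n. c n \<noteq> 0}. \<bar>n\<bar> \<le> R"
    using fin F by (auto simp: R_def)
  \<comment> \<open>The indices \<open>m\<close> and \<open>j - k\<close> below differ by at most \<open>3 * R\<close>.\<close>
  define M where "M = nat (4 * \<bar>R\<bar> + 1)"
  have M: "0 < M" by (simp add: M_def)
  define w where "w = unity_root M"
  have nw: "norm (w k) = 1" "w k \<noteq> 0" for k by (simp_all add: w_def unity_root_def)
  have inv: "c (j - k) = (\<Sum>i<M. symbol c (w i) * w i powi (- (j - k))) / of_nat M"
    if "j \<in> F" "k \<in> F" for j k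
  proof -
    have "m = j - k" if "c m \<noteq> 0" "int M dvd m - (j - k)" for m
    proof -
      have "\<bar>m\<bar> \<le> R" "\<bar>j\<bar> \<le> R" "\<bar>k\<bar> \<le> R" using R that \<open>j \<in> F\<close> \<open>k \<in> F\<close> by auto
      then have "\<bar>m - (j - k)\<bar> < int M" by (simp add: M_def)
      then have "m - (j - k) = 0" using dvd_imp_le_int[OF _ that(2)] by fastforce
      then show ?thesis by simp
    qed
    then show ?thesis using symbol_inversion[OF M fin, of "j - k"] M by (simp add: w_def)
  qed
  have "(\<Sum>j\<in>F. \<Sum>k\<in>F. z j * cnj (z k) * c (j - k)) =
     (\<Sum>j\<in>F. \<Sum>k\<in>F. \<Sum>i<M. symbol c (w i) / of_nat M * (z j * w i powi (- j) * cnj (z k * w i powi (- k))))"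
  proof (intro sum.cong refl)
    fix j k assume "j \<in> F" "k \<in> F"
    have "cnj (w i powi (- k)) = w i powi k" for i
      using cnj_unit_powi[OF nw(1), of i "- k"] by simp
    then show "z j * cnj (z k) * c (j - k) =
      (\<Sum>i<M. symbol c (w i) / of_nat M * (z j * w i powi (- j) * cnj (z k * w i powi (- k))))"
      unfolding inv[OF \<open>j \<in> F\<close> \<open>k \<in> F\<close>] sum_divide_distrib sum_distrib_left
      by (intro sum.cong refl) (simp add: power_int_diff power_int_minus nw field_simps del: complex_cnj_power_int)
  qed
  also have "\<dots> = (\<Sum>i<M. \<Sum>j\<in>F. \<Sum>k\<in>F. symbol c (w i) / of_nat M * (z j * w i powi (- j) * cnj (z k * w i powi (- k))))"
    by (subst (2) sum.swap, subst sum.swap, rule refl)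
  also have "\<dots> = (\<Sum>i<M. symbol c (w i) / of_nat M * ((\<Sum>j\<in>F. z j * w i powi (- j)) * cnj (\<Sum>j\<in>F. z j * w i powi (- j))))"
    unfolding cnj_sum unfolding sum_product unfolding sum_distrib_left ..
  also have "\<dots> \<in> \<real>\<^sub>\<ge>\<^sub>0"
    by (intro nonneg_Reals_sum nonneg_Reals_mult_I nonneg_Reals_divide_I nonneg_Reals_mult_cnj pos nw)
      simp
  finally show "(\<Sum>j\<in>F. \<Sum>k\<in>F. z j * cnj (z k) * c (j - k)) \<in> \<real>\<^sub>\<ge>\<^sub>0" .
qed

lemma card_translate_overlap: "card {j \<in> {0..<int R}. j - n \<in> {0..<int R}} = nat (int R - \<bar>n\<bar>)"
proof -
  have "{j \<in> {0..<int R}. j - n \<in> {0..<int R}} = {max 0 n..<min (int R) (int R + n)}" by auto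
  then show ?thesis by (auto simp: max_def min_def)
qed

text \<open>Testing positive definiteness with the vector \<open>z^j\<close>, \<open>0 \<le> j < R\<close>, gives nonnegativity of the Fejer means of
  the symbol; these converge to the symbol since the support is finite.\<close>

lemma symbol_nonneg:
  assumes pd: "positive_definite_int c" and fin: "finite {n. c n \<noteq> 0}" and z: "norm z = 1"
  shows "symbol c z \<in> \<real>\<^sub>\<ge>\<^sub>0"
proof -
  define S where "S = {n. c n \<noteq> 0}"
  define t where "t n = c n * z powi n" for n
  have z0: "z \<noteq> 0" using z by auto
  have eq: "(\<Sum>j\<in>F. \<Sum>k\<in>F. z powi j * cnj (z powi k) * c (j - k))
     = (\<Sum>n\<in>S. t n * of_nat (card {j\<in>F. j - n \<in> F}))" if F: "finite F" for F
  proof -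
    have "(\<Sum>j\<in>F. \<Sum>k\<in>F. z powi j * cnj (z powi k) * c (j - k)) = (\<Sum>j\<in>F. \<Sum>k\<in>F. t (j - k))"
      by (intro sum.cong refl) (simp add: cnj_unit_powi[OF z] t_def power_int_diff power_int_minus z0 field_simps del: complex_cnj_power_int)
    also have "\<dots> = (\<Sum>j\<in>F. \<Sum>n\<in>S. if j - n \<in> F then t n else 0)"
    proof (rule sum.cong[OF refl])
      fix j
      have "(\<Sum>k\<in>F. t (j - k)) = (\<Sum>n\<in>{n\<in>S. j - n \<in> F}. t n)"
        using F fin
        by (intro sum.reindex_bij_witness_not_neutral[of "{k\<in>F. t (j - k) = 0}" "{}" _ "\<lambda>n. j - n" "\<lambda>k. j - k"])
           (auto simp: S_def t_def z0)
      then show "(\<Sum>k\<in>F. t (j - k)) = (\<Sum>n\<in>S. if j - n \<in> F then t n else 0)"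
        using fin by (simp add: S_def sum.If_cases Int_def)
    qed
    also have "\<dots> = (\<Sum>n\<in>S. t n * of_nat (card {j\<in>F. j - n \<in> F}))"
      using F by (subst sum.swap) (simp add: sum.If_cases Int_def mult.commute)
    finally show ?thesis .
  qed
  define a where "a R = (\<Sum>n\<in>S. t n * of_real (real (nat (int R - \<bar>n\<bar>)) / real R))" for R
  have a: "a R \<in> \<real>\<^sub>\<ge>\<^sub>0" if "0 < R" for R
  proof -
    have "a R = (\<Sum>j\<in>{0..<int R}. \<Sum>k\<in>{0..<int R}. z powi j * cnj (z powi k) * c (j - k)) / of_nat R"
      unfolding eq[OF finite_atLeastLessThan_int] card_translate_overlap a_def sum_divide_distrib
      by (intro sum.cong refl) simp
    then show ?thesis
      by (simp only: nonneg_Reals_divide_I[OF pd_intD[OF pd finite_atLeastLessThan_int] nonneg_Reals_of_nat_I])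
  qed
  have lim: "(\<lambda>R. real (nat (int R - \<bar>n\<bar>)) / real R) \<longlonglongrightarrow> 1" for n
  proof (rule Lim_transform_eventually)
    show "(\<lambda>R. 1 - real_of_int \<bar>n\<bar> / real R) \<longlonglongrightarrow> 1"
      using tendsto_diff[OF tendsto_const[of 1] lim_const_over_n[of "real_of_int \<bar>n\<bar>"]] by simp
    show "\<forall>\<^sub>F R in sequentially. 1 - real_of_int \<bar>n\<bar> / real R = real (nat (int R - \<bar>n\<bar>)) / real R"
      using eventually_ge_at_top[of "nat \<bar>n\<bar> + 1"] by eventually_elim (auto simp: field_simps)
  qed
  have "a \<longlonglongrightarrow> (\<Sum>n\<in>S. t n * of_real 1)"
    unfolding a_def by (intro tendsto_sum tendsto_mult tendsto_const tendsto_of_real lim)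
  then have "(\<Sum>n\<in>S. t n * of_real 1) \<in> \<real>\<^sub>\<ge>\<^sub>0"
    using Lim_in_closed_set[OF closed_nonneg_Reals_complex
        eventually_mono[OF eventually_gt_at_top[of 0] a] sequentially_bot] by simp
  then show ?thesis by (simp add: symbol_def S_def t_def)
qed

section \<open>Piecewise linear interpolation\<close>

definition tent :: "real \<Rightarrow> real" where
  "tent x = max 0 (1 - \<bar>x\<bar>)"

definition interp :: "(int \<Rightarrow> complex) \<Rightarrow> real \<Rightarrow> complex" where
  "interp c s = (\<Sum>n | c n \<noteq> 0. of_real (tent (s - of_int n)) * c n)"

lemma interp_eq_sum:
  assumes "finite S" "\<And>n. n \<notin> S \<Longrightarrow> c n = 0"
  shows "interp c s = (\<Sum>n\<in>S. of_real (tent (s - of_int n)) * c n)"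
  unfolding interp_def using assms by (intro sum.mono_neutral_left) auto

text \<open>At most the two integers next to \<open>s\<close> lie within distance one.\<close>

lemma interp_floor:
  assumes "finite {n. c n \<noteq> 0}"
  shows "interp c s = of_real (1 - frac s) * c \<lfloor>s\<rfloor> + of_real (frac s) * c (\<lfloor>s\<rfloor> + 1)"
proof -
  define S where "S = insert \<lfloor>s\<rfloor> (insert (\<lfloor>s\<rfloor> + 1) {n. c n \<noteq> 0})"
  have "tent (s - of_int n) = 0" if "n \<noteq> \<lfloor>s\<rfloor>" "n \<noteq> \<lfloor>s\<rfloor> + 1" for n
  proof -
    have "n < \<lfloor>s\<rfloor> \<or> n > \<lfloor>s\<rfloor> + 1" using that by linarith
    then have "\<bar>s - of_int n\<bar> \<ge> 1" by linarith
    then show ?thesis by (simp add: tent_def)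
  qed
  then have "(\<Sum>n\<in>S. of_real (tent (s - of_int n)) * c n) =
      (\<Sum>n\<in>{\<lfloor>s\<rfloor>, \<lfloor>s\<rfloor> + 1}. of_real (tent (s - of_int n)) * c n)"
    using assms by (intro sum.mono_neutral_right) (auto simp: S_def)
  then have "interp c s = (\<Sum>n\<in>{\<lfloor>s\<rfloor>, \<lfloor>s\<rfloor> + 1}. of_real (tent (s - of_int n)) * c n)"
    using assms by (subst interp_eq_sum[of S]) (auto simp: S_def)
  moreover have "tent (s - of_int \<lfloor>s\<rfloor>) = 1 - frac s" "tent (s - of_int (\<lfloor>s\<rfloor> + 1)) = frac s"
    using frac_lt_1[of s] frac_ge_0[of s] by (auto simp: tent_def frac_def)
  ultimately show ?thesis by simp
qed

lemma has_integral_two_values: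
  fixes f :: "real \<Rightarrow> complex"
  assumes pq: "0 \<le> p" "p \<le> q" "q \<le> 1"
    and outer: "\<And>u. 0 < u \<Longrightarrow> u < p \<Longrightarrow> f u = x" "\<And>u. q < u \<Longrightarrow> u < 1 \<Longrightarrow> f u = x"
    and inner: "\<And>u. p < u \<Longrightarrow> u < q \<Longrightarrow> f u = y"
  shows "(f has_integral of_real (1 - (q - p)) * x + of_real (q - p) * y) {0..1}"
proof -
  have const: "(f has_integral of_real (b - a) * v) {a..b}"
    if "a \<le> b" "\<And>u. a < u \<Longrightarrow> u < b \<Longrightarrow> f u = v" for a b v
  proof (rule has_integral_spike_finite[of "{a, b}"])
    show "((\<lambda>_. v) has_integral of_real (b - a) * v) {a..b}"
      using has_integral_const_real[of v a b] that(1) by (simp add: scaleR_conv_of_real)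
  qed (use that(2) in \<open>auto simp: order_le_less\<close>)
  have "(f has_integral of_real (p - 0) * x + of_real (q - p) * y) {0..q}"
    using pq by (intro has_integral_combine[of 0 p q] const outer inner) auto
  then have "(f has_integral of_real (p - 0) * x + of_real (q - p) * y + of_real (1 - q) * x) {0..1}"
    using pq by (intro has_integral_combine[of 0 q 1] const outer) auto
  then show ?thesis by (simp add: algebra_simps)
qed

text \<open>For \<open>u\<close> uniform in the unit interval, \<open>\<lfloor>a + u\<rfloor> - \<lfloor>b + u\<rfloor>\<close> takes the two integers next to \<open>a - b\<close>,
  with the interpolation weights of \<open>a - b\<close> as probabilities.  Interpolation is thus an average over
  random roundings of the points to integers.\<close>

lemma has_integral_floor_difference:
  assumes "finite {n. c n \<noteq> 0}"
  shows "((\<lambda>u. c (\<lfloor>a + u\<rfloor> - \<lfloor>b + u\<rfloor>)) has_integral interp c (a - b)) {0..1}"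
proof -
  have a: "0 \<le> frac a" "frac a < 1" and b: "0 \<le> frac b" "frac b < 1"
    by (auto simp: frac_lt_1)
  have lo: "\<lfloor>t + u\<rfloor> = \<lfloor>t\<rfloor>" if "0 \<le> u" "u < 1 - frac t" for t u :: real
    using that unfolding frac_def floor_eq_iff by linarith
  have hi: "\<lfloor>t + u\<rfloor> = \<lfloor>t\<rfloor> + 1" if "1 - frac t \<le> u" "u < 1" for t u :: real
    using that unfolding frac_def floor_eq_iff of_int_add of_int_1 by linarith
  show ?thesis
  proof (cases "frac b \<le> frac a")
    case True
    have "\<lfloor>a - b\<rfloor> = \<lfloor>a\<rfloor> - \<lfloor>b\<rfloor>"
      using True a b unfolding frac_def floor_eq_iff of_int_diff by linarith
    moreover from this have "frac (a - b) = frac a - frac b" by (simp add: frac_def)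
    moreover have "((\<lambda>u. c (\<lfloor>a + u\<rfloor> - \<lfloor>b + u\<rfloor>)) has_integral
       of_real (1 - ((1 - frac b) - (1 - frac a))) * c (\<lfloor>a\<rfloor> - \<lfloor>b\<rfloor>) +
       of_real ((1 - frac b) - (1 - frac a)) * c (\<lfloor>a\<rfloor> - \<lfloor>b\<rfloor> + 1)) {0..1}"
    proof (rule has_integral_two_values)
      fix u :: real
      show "c (\<lfloor>a + u\<rfloor> - \<lfloor>b + u\<rfloor>) = c (\<lfloor>a\<rfloor> - \<lfloor>b\<rfloor>)" if "0 < u" "u < 1 - frac a"
        using lo[of u a] lo[of u b] that True by simp
      show "c (\<lfloor>a + u\<rfloor> - \<lfloor>b + u\<rfloor>) = c (\<lfloor>a\<rfloor> - \<lfloor>b\<rfloor>)" if "1 - frac b < u" "u < 1"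
        using hi[of a u] hi[of b u] that True by simp
      show "c (\<lfloor>a + u\<rfloor> - \<lfloor>b + u\<rfloor>) = c (\<lfloor>a\<rfloor> - \<lfloor>b\<rfloor> + 1)" if "1 - frac a < u" "u < 1 - frac b"
        using hi[of a u] lo[of u b] that a b by (simp add: algebra_simps)
    qed (use True a b in auto)
    ultimately show ?thesis by (simp add: interp_floor[OF assms])
  next
    case False
    have "\<lfloor>a - b\<rfloor> = \<lfloor>a\<rfloor> - \<lfloor>b\<rfloor> - 1"
      using False a b unfolding frac_def floor_eq_iff of_int_diff of_int_1 by linarith
    moreover from this have "frac (a - b) = 1 + frac a - frac b" by (simp add: frac_def)
    moreover have "((\<lambda>u. c (\<lfloor>a + u\<rfloor> - \<lfloor>b + u\<rfloor>)) has_integral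
       of_real (1 - ((1 - frac a) - (1 - frac b))) * c (\<lfloor>a\<rfloor> - \<lfloor>b\<rfloor>) +
       of_real ((1 - frac a) - (1 - frac b)) * c (\<lfloor>a\<rfloor> - \<lfloor>b\<rfloor> - 1)) {0..1}"
    proof (rule has_integral_two_values)
      fix u :: real
      show "c (\<lfloor>a + u\<rfloor> - \<lfloor>b + u\<rfloor>) = c (\<lfloor>a\<rfloor> - \<lfloor>b\<rfloor>)" if "0 < u" "u < 1 - frac b"
        using lo[of u a] lo[of u b] that False by simp
      show "c (\<lfloor>a + u\<rfloor> - \<lfloor>b + u\<rfloor>) = c (\<lfloor>a\<rfloor> - \<lfloor>b\<rfloor>)" if "1 - frac a < u" "u < 1"
        using hi[of a u] hi[of b u] that False by simp
      show "c (\<lfloor>a + u\<rfloor> - \<lfloor>b + u\<rfloor>) = c (\<lfloor>a\<rfloor> - \<lfloor>b\<rfloor> - 1)" if "1 - frac b < u" "u < 1 - frac a"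
        using hi[of b u] lo[of u a] that a b by (simp add: algebra_simps)
    qed (use False a b in auto)
    moreover have "1 - ((1 - frac a) - (1 - frac b)) = 1 + frac a - frac b" by simp
    ultimately show ?thesis by (simp only: interp_floor[OF assms]) (simp add: add.commute)
  qed
qed

text \<open>The points may coincide: vectors belonging to the same integer are added up.\<close>

lemma pd_int_indexed:
  fixes m :: nat and i :: "nat \<Rightarrow> int"
  assumes "positive_definite_int c"
  shows "(\<Sum>j<m. \<Sum>k<m. z j * cnj (z k) * c (i j - i k)) \<in> \<real>\<^sub>\<ge>\<^sub>0"
proof -
  define Z where "Z n = (\<Sum>j | j \<in> {..<m} \<and> i j = n. z j)" for n
  have "(\<Sum>j<m. \<Sum>k<m. z j * cnj (z k) * c (i j - i k))
      = (\<Sum>n\<in>i ` {..<m}. \<Sum>j | j \<in> {..<m} \<and> i j = n. \<Sum>n'\<in>i ` {..<m}. \<Sum>k | k \<in> {..<m} \<and> i k = n'.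
          z j * cnj (z k) * c (n - n'))"
    by (subst sum.image_gen[of _ _ i], simp, intro sum.cong refl, subst sum.image_gen[of _ _ i], simp,
        intro sum.cong refl) auto
  also have "\<dots> = (\<Sum>n\<in>i ` {..<m}. \<Sum>n'\<in>i ` {..<m}. \<Sum>j | j \<in> {..<m} \<and> i j = n. \<Sum>k | k \<in> {..<m} \<and> i k = n'.
          z j * cnj (z k) * c (n - n'))"
    by (intro sum.cong refl sum.swap)
  also have "\<dots> = (\<Sum>n\<in>i ` {..<m}. \<Sum>n'\<in>i ` {..<m}. Z n * cnj (Z n') * c (n - n'))"
    unfolding Z_def cnj_sum unfolding sum_product unfolding sum_distrib_right ..
  also have "\<dots> \<in> \<real>\<^sub>\<ge>\<^sub>0"
    by (rule pd_intD[OF assms]) simp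
  finally show ?thesis .
qed

text \<open>By \<open>has_integral_floor_difference\<close> the quadratic form of the interpolation is the integral over \<open>u\<close> of
  the quadratic forms of \<open>c\<close> at the rounded points \<open>\<lfloor>x j + u\<rfloor>\<close>.\<close>

lemma pd_real_interp:
  assumes "positive_definite_int c" "finite {n. c n \<noteq> 0}"
  shows "positive_definite_real (interp c)"
  unfolding positive_definite_real_def
proof (intro allI)
  fix m and x :: "nat \<Rightarrow> real" and z :: "nat \<Rightarrow> complex"
  define Q where "Q u = (\<Sum>j<m. \<Sum>k<m. z j * cnj (z k) * c (\<lfloor>x j + u\<rfloor> - \<lfloor>x k + u\<rfloor>))" for u
  define I where "I = (\<Sum>j<m. \<Sum>k<m. z j * cnj (z k) * interp c (x j - x k))"
  have int: "(Q has_integral I) {0..1}"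
    unfolding Q_def I_def
    by (intro has_integral_sum has_integral_mult_right has_integral_floor_difference[OF assms(2)]) auto
  have Q: "Q u \<in> \<real>\<^sub>\<ge>\<^sub>0" for u unfolding Q_def by (rule pd_int_indexed[OF assms(1)])
  have "((\<lambda>u. Re (Q u)) has_integral Re I) {0..1}" "((\<lambda>u. Im (Q u)) has_integral Im I) {0..1}"
    using has_integral_linear[OF int bounded_linear_Re] has_integral_linear[OF int bounded_linear_Im]
    by (simp_all add: o_def)
  then have "Re I \<ge> 0" "Im I = 0"
    using Q has_integral_nonneg[of "\<lambda>u. Re (Q u)"] has_integral_unique[OF _ has_integral_0]
    by (auto simp: complex_nonneg_Reals_iff)
  then show "I \<in> \<real>\<^sub>\<ge>\<^sub>0" by (simp add: complex_nonneg_Reals_iff)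
qed

lemma pd_real_scale_argument:
  assumes "positive_definite_real f"
  shows "positive_definite_real (\<lambda>x. f (r * x))"
  unfolding positive_definite_real_def
proof (intro allI)
  fix m and x :: "nat \<Rightarrow> real" and z :: "nat \<Rightarrow> complex"
  have "(\<Sum>j<m. \<Sum>k<m. z j * cnj (z k) * f (r * x j - r * x k)) \<in> \<real>\<^sub>\<ge>\<^sub>0"
    using assms unfolding positive_definite_real_def by simp
  then show "(\<Sum>j<m. \<Sum>k<m. z j * cnj (z k) * f (r * (x j - x k))) \<in> \<real>\<^sub>\<ge>\<^sub>0"
    by (simp add: right_diff_distrib)
qed

lemma continuous_on_interp: "continuous_on UNIV (interp c)"
  unfolding interp_def tent_def by (intro continuous_intros)

lemma interp_0: "finite {n. c n \<noteq> 0} \<Longrightarrow> interp c 0 = c 0"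
  by (simp add: interp_floor)

lemma interp_nonzero:
  assumes "interp c s \<noteq> 0"
  obtains n where "c n \<noteq> 0" "\<bar>s - of_int n\<bar> < 1"
proof -
  obtain n where "c n \<noteq> 0" "of_real (tent (s - of_int n)) * c n \<noteq> 0"
    using assms unfolding interp_def by (rule sum.not_neutral_contains_not_neutral) simp
  then show ?thesis using that by (auto simp: tent_def max_def split: if_splits)
qed

lemma has_bochner_integral_tent: "has_bochner_integral lborel tent 1"
proof -
  have "((\<lambda>x. x - x\<^sup>2 / 2) has_real_derivative 1 - x) (at x)"
    "((\<lambda>x. x + x\<^sup>2 / 2) has_real_derivative 1 + x) (at x)" for x :: real
    by (auto intro!: derivative_eq_intros)
  note D = this
  have 1: "has_bochner_integral lborel (\<lambda>x. (1 - x) * indicator {0..1} x) (1/2 :: real)"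
    using has_bochner_integral_FTC_Icc_nonneg[OF _ D(1), of 0 1] by simp
  have 2: "has_bochner_integral lborel (\<lambda>x. (1 + x) * indicator {-1..0} x) (1/2 :: real)"
    using has_bochner_integral_FTC_Icc_nonneg[OF _ D(2), of "-1" 0] by simp
  have "AE x in lborel. (1 - x) * indicator {0..1} x + (1 + x) * indicator {-1..0} x = tent x"
    using AE_lborel_singleton[of 0] by eventually_elim (auto simp: tent_def indicator_def)
  then have "has_bochner_integral lborel tent (1/2 + 1/2)"
    using has_bochner_integral_add[OF 1 2]
    by (subst has_bochner_integral_cong_AE[symmetric]) (auto simp: tent_def[abs_def])
  then show ?thesis by simp
qed

text \<open>A tent has unit mass, so the integral is the total mass of the coefficients, which is the symbol at
  \<open>1\<close>.\<close>

lemma has_bochner_integral_interp: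
  assumes "0 < r"
  shows "has_bochner_integral lborel (\<lambda>x. interp c (r * x)) (symbol c 1 / of_real r)"
proof -
  have "has_bochner_integral lborel (\<lambda>x. of_real (tent (r * x - of_int n)) * c n) (of_real (1 / r) * c n)" for n
  proof -
    have "has_bochner_integral lborel (\<lambda>x. tent (- of_int n + r * x)) (1 /\<^sub>R \<bar>r\<bar>)"
      using lborel_has_bochner_integral_real_affine_iff[of r tent 1 "- of_int n"] assms has_bochner_integral_tent
      by simp
    then have "has_bochner_integral lborel (\<lambda>x. tent (r * x - of_int n)) (1 / r)"
      using assms by (simp add: add.commute[of "- real_of_int n"] divide_inverse)
    then have "has_bochner_integral lborel (\<lambda>x. complex_of_real (tent (r * x - of_int n))) (of_real (1 / r))"
      by (rule has_bochner_integral_of_real)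
    then show ?thesis by (rule has_bochner_integral_mult_left)
  qed
  then have "has_bochner_integral lborel (\<lambda>x. interp c (r * x)) (\<Sum>n | c n \<noteq> 0. of_real (1 / r) * c n)"
    unfolding interp_def
    by (rule has_bochner_integral_sum[where f = "\<lambda>n x. of_real (tent (r * x - of_int n)) * c n"])
  moreover have "(\<Sum>n | c n \<noteq> 0. of_real (1 / r) * c n) = symbol c 1 / of_real r"
    by (simp add: symbol_def sum_divide_distrib)
  ultimately show ?thesis by simp
qed

section \<open>Admissible functions, admissible sequences, and sampling\<close>

lemma pd_real_sample:
  assumes "positive_definite_real f"
  shows "positive_definite_int (\<lambda>n. f (of_int n * h))"
  unfolding positive_definite_int_def
proof (intro allI impI)
  fix F :: "int set" and z assume "finite F"
  then obtain e where e: "bij_betw e {..<card F} F"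
    using ex_bij_betw_nat_finite[of F] by (auto simp: lessThan_atLeast0)
  have "(\<Sum>j\<in>F. \<Sum>k\<in>F. z j * cnj (z k) * f (of_int (j - k) * h)) =
    (\<Sum>j<card F. \<Sum>k<card F. z (e j) * cnj (z (e k)) * f (of_int (e j) * h - of_int (e k) * h))"
    by (simp add: sum.reindex_bij_betw[OF e, symmetric] left_diff_distrib)
  also have "\<dots> \<in> \<real>\<^sub>\<ge>\<^sub>0"
    using assms unfolding positive_definite_real_def by simp
  finally show "(\<Sum>j\<in>F. \<Sum>k\<in>F. z j * cnj (z k) * f (of_int (j - k) * h)) \<in> \<real>\<^sub>\<ge>\<^sub>0" .
qed

lemma pd_real_bound:
  assumes "positive_definite_real f"
  shows "norm (f x) \<le> Re (f 0)"
  using pd_int_bound[OF pd_real_sample[OF assms, of x], of 1] by simp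

definition turan_function :: "real set \<Rightarrow> (real \<Rightarrow> complex) \<Rightarrow> bool" where
  "turan_function \<Omega> f \<longleftrightarrow>
     continuous_on UNIV f \<and> positive_definite_real f \<and> f 0 = 1 \<and> closed_support f \<subseteq> \<Omega>"

definition turan_sequence :: "int set \<Rightarrow> (int \<Rightarrow> complex) \<Rightarrow> bool" where
  "turan_sequence A c \<longleftrightarrow> positive_definite_int c \<and> c 0 = 1 \<and> (\<forall>n. n \<notin> A \<longrightarrow> c n = 0)"

lemma turan_real_eq: "turan_real \<Omega> = Sup {Re (LINT x|lborel. f x) | f. turan_function \<Omega> f}"
  by (simp add: turan_real_def turan_function_def)

lemma turan_int_eq: "turan_int A = Sup {Re (\<Sum>n\<in>A. c n) | c. turan_sequence A c}"
  by (simp add: turan_int_def turan_sequence_def)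

lemma turan_function_integral_bound:
  assumes f: "turan_function \<Omega> f" and \<Omega>: "\<Omega> \<subseteq> {-R..R}" and R: "0 \<le> R"
  shows "Re (LINT x|lborel. f x) \<le> 2 * R"
proof -
  have cont: "continuous_on {-R..R} f" and pd: "positive_definite_real f" "f 0 = 1"
    using f by (auto simp: turan_function_def intro: continuous_on_subset)
  have zero: "f x = 0" if "x \<notin> {-R..R}" for x
  proof (rule ccontr)
    assume "f x \<noteq> 0"
    then have "x \<in> closed_support f"
      unfolding closed_support_def using closure_subset[of "{x. f x \<noteq> 0}"] by blast
    then show False using f \<Omega> that unfolding turan_function_def by blast
  qed
  have bd: "norm (f x) \<le> indicator {-R..R} x" for x
    using pd_real_bound[OF pd(1), of x] pd(2) zero[of x] by (auto simp: indicator_def)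
  have "f = (\<lambda>x. indicator {-R..R} x *\<^sub>R f x)" using zero by (auto simp: indicator_def)
  moreover have "integrable lborel (\<lambda>x. indicator {-R..R} x *\<^sub>R f x)"
    by (intro borel_integrable_compact cont compact_Icc)
  ultimately have int: "integrable lborel f" by simp
  have "Re (LINT x|lborel. f x) \<le> norm (LINT x|lborel. f x)" by (rule complex_Re_le_cmod)
  also have "\<dots> \<le> (LINT x|lborel. norm (f x))" by (rule integral_norm_bound)
  also have "\<dots> \<le> (LINT x|lborel. indicator {-R..R} x)"
    using int bd by (intro integral_mono integrable_norm integrable_real_indicator)
      (auto simp: emeasure_lborel_Icc_eq)
  also have "\<dots> = 2 * R" using R by simp
  finally show "Re (LINT x|lborel. f x) \<le> 2 * R" .
qed

lemma Omega_bounded: "Omega lam \<subseteq> {- (\<bar>lam\<bar> + 1)..\<bar>lam\<bar> + 1}"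
  unfolding Omega_def by auto

text \<open>The supremum is over a bounded set, because a positive definite function is bounded by its value at
  \<open>0\<close>.\<close>

lemma turan_real_upper:
  assumes "turan_function (Omega lam) f"
  shows "Re (LINT x|lborel. f x) \<le> turan_real (Omega lam)"
  unfolding turan_real_eq
proof (rule cSup_upper)
  show "bdd_above {Re (LINT x|lborel. f x) | f. turan_function (Omega lam) f}"
    using turan_function_integral_bound[OF _ Omega_bounded]
    by (intro bdd_aboveI[of _ "2 * (\<bar>lam\<bar> + 1)"]) auto
qed (use assms in auto)

lemma turan_function_exists: "turan_function (Omega lam) (\<lambda>x. interp (impulse 0) (2 * x))"
  unfolding turan_function_def
proof (intro conjI)
  show "continuous_on UNIV (\<lambda>x. interp (impulse 0) (2 * x))"
    by (rule continuous_on_compose2[OF continuous_on_interp]) (auto intro!: continuous_intros)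
  show "positive_definite_real (\<lambda>x. interp (impulse 0) (2 * x))"
    by (intro pd_real_scale_argument pd_real_interp pd_int_impulse finite_support_impulse)
  show "interp (impulse 0) (2 * 0) = 1"
    by (simp add: interp_0 finite_support_impulse) (simp add: impulse_def)
  have "{x. interp (impulse 0) (2 * x) \<noteq> 0} \<subseteq> {-1/2..1/2}"
  proof safe
    fix x assume "interp (impulse 0) (2 * x) \<noteq> 0"
    then obtain n where "impulse 0 n \<noteq> 0" "\<bar>2 * x - of_int n\<bar> < 1" by (rule interp_nonzero)
    then show "x \<in> {-1/2..1/2}" by (auto simp: impulse_def split: if_splits)
  qed
  then have "closed_support (\<lambda>x. interp (impulse 0) (2 * x)) \<subseteq> {-1/2..1/2}"
    unfolding closed_support_def by (rule closure_minimal) simp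
  then show "closed_support (\<lambda>x. interp (impulse 0) (2 * x)) \<subseteq> Omega lam"
    by (fastforce simp: Omega_def)
qed

lemma turan_real_approx:
  assumes "y < turan_real (Omega lam)"
  obtains f where "turan_function (Omega lam) f" "y < Re (LINT x|lborel. f x)"
proof -
  have "\<exists>t\<in>{Re (LINT x|lborel. f x) | f. turan_function (Omega lam) f}. y < t"
    using assms unfolding turan_real_eq
    by (rule less_cSupE) (use turan_function_exists[of lam] in auto)
  then show ?thesis using that by auto
qed

lemma turan_sequence_bound:
  assumes "turan_sequence A c"
  shows "norm (c n) \<le> 1"
  using pd_int_bound[of c n] assms by (simp add: turan_sequence_def)

lemma turan_int_upper:
  assumes "turan_sequence A c"
  shows "Re (\<Sum>n\<in>A. c n) \<le> turan_int A"
  unfolding turan_int_eq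
proof (rule cSup_upper)
  show "bdd_above {Re (\<Sum>n\<in>A. c n) | c. turan_sequence A c}"
  proof (intro bdd_aboveI[of _ "real (card A)"])
    fix t assume "t \<in> {Re (\<Sum>n\<in>A. c n) | c. turan_sequence A c}"
    then obtain c where c: "turan_sequence A c" and t: "t = Re (\<Sum>n\<in>A. c n)" by blast
    have "t \<le> norm (\<Sum>n\<in>A. c n)" unfolding t by (rule complex_Re_le_cmod)
    also have "\<dots> \<le> of_nat (card A) * 1" using turan_sequence_bound[OF c] by (intro sum_norm_bound)
    finally show "t \<le> real (card A)" by simp
  qed
qed (use assms in auto)

lemma turan_int_least:
  assumes "0 \<in> A" "\<And>c. turan_sequence A c \<Longrightarrow> Re (\<Sum>n\<in>A. c n) \<le> b"
  shows "turan_int A \<le> b"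
  unfolding turan_int_eq
proof (rule cSup_least)
  have "turan_sequence A (impulse 0)"
    using assms(1) pd_int_impulse by (auto simp: turan_sequence_def impulse_def)
  then show "{Re (\<Sum>n\<in>A. c n) | c. turan_sequence A c} \<noteq> {}" by blast
qed (use assms(2) in auto)

lemma finite_A_set: "finite (A_set N lam)"
proof -
  have "A_set N lam \<subseteq> {- \<lceil>real N * \<bar>lam\<bar> + real N\<rceil>..\<lceil>real N * \<bar>lam\<bar> + real N\<rceil>}"
  proof
    fix n assume "n \<in> A_set N lam"
    then have "\<bar>real_of_int n\<bar> \<le> real N * \<bar>lam\<bar> + real N"
      unfolding A_set_def using abs_mult[of "real N" lam] mult_nonneg_nonneg[of "real N" "\<bar>lam\<bar>"]
      by auto
    then show "n \<in> {- \<lceil>real N * \<bar>lam\<bar> + real N\<rceil>..\<lceil>real N * \<bar>lam\<bar> + real N\<rceil>}"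
      by (simp add: abs_le_iff) linarith
  qed
  then show ?thesis by (rule finite_subset) simp
qed

text \<open>The largest of the three signed distances of \<open>x\<close> to the complements of the intervals is continuous,
  positive on the open set, and attains its minimum on a compact set.\<close>

lemma compact_in_Omega_margin:
  assumes "compact K" "K \<subseteq> Omega lam"
  obtains \<delta> where "0 < \<delta>"
    "\<And>x. x \<in> K \<Longrightarrow> \<bar>x\<bar> \<le> 1 - \<delta> \<or> \<bar>x - lam\<bar> \<le> 1 - \<delta> \<or> \<bar>x + lam\<bar> \<le> 1 - \<delta>"
proof (cases "K = {}")
  case True
  then show ?thesis using that[of 1] by simp
next
  case False
  define \<psi> where "\<psi> x = max (1 - \<bar>x\<bar>) (max (1 - \<bar>x - lam\<bar>) (1 - \<bar>x + lam\<bar>))" for x :: real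
  have "continuous_on K \<psi>" unfolding \<psi>_def by (intro continuous_intros)
  then obtain x0 where x0: "x0 \<in> K" "\<And>x. x \<in> K \<Longrightarrow> \<psi> x0 \<le> \<psi> x"
    using continuous_attains_inf[OF assms(1) False] by blast
  \<comment> \<open>On the open set one of the three terms of \<open>\<psi>\<close> is positive.\<close>
  have "0 < \<psi> x0" using x0(1) assms(2) by (force simp: \<psi>_def Omega_def less_max_iff_disj)
  moreover have "\<bar>x\<bar> \<le> 1 - \<psi> x0 \<or> \<bar>x - lam\<bar> \<le> 1 - \<psi> x0 \<or> \<bar>x + lam\<bar> \<le> 1 - \<psi> x0" if "x \<in> K" for x
    using x0(2)[OF that] by (auto simp: \<psi>_def[of x] le_max_iff_disj)
  ultimately show ?thesis by (rule that)
qed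

lemma floor_quotient_tendsto:
  "(\<lambda>k. of_int (\<lfloor>real (Suc k) * x\<rfloor> + i) / real (Suc k)) \<longlonglongrightarrow> x" for i :: int
proof -
  have "(\<lambda>k. of_int (\<lfloor>real (Suc k) * x\<rfloor> + i) / real (Suc k) - x) \<longlonglongrightarrow> 0"
  proof (rule Lim_null_comparison)
    show "(\<lambda>k. (1 + \<bar>of_int i\<bar>) / real (Suc k)) \<longlonglongrightarrow> 0"
      by (rule LIMSEQ_Suc[OF lim_const_over_n])
    show "\<forall>\<^sub>F k in sequentially. norm (of_int (\<lfloor>real (Suc k) * x\<rfloor> + i) / real (Suc k) - x) \<le> (1 + \<bar>of_int i\<bar>) / real (Suc k)"
    proof (rule always_eventually, rule allI)
      fix k
      have "of_int (\<lfloor>real (Suc k) * x\<rfloor> + i) / real (Suc k) - x = (of_int (\<lfloor>real (Suc k) * x\<rfloor> + i) - real (Suc k) * x) / real (Suc k)"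
        by (simp add: field_simps)
      moreover have "\<bar>of_int (\<lfloor>real (Suc k) * x\<rfloor> + i) - real (Suc k) * x\<bar> \<le> 1 + \<bar>of_int i\<bar>"
        by linarith
      ultimately show "norm (of_int (\<lfloor>real (Suc k) * x\<rfloor> + i) / real (Suc k) - x) \<le> (1 + \<bar>of_int i\<bar>) / real (Suc k)"
        by (simp add: divide_right_mono del: of_nat_Suc)
    qed
  qed
  then show ?thesis by (rule LIM_zero_cancel)
qed

text \<open>Riemann sums are integrals of piecewise linear interpolations of \<open>f\<close>, which converge to \<open>f\<close>
  pointwise, are bounded by \<open>B\<close>, and vanish outside a common bounded interval; dominated convergence
  applies.\<close>

lemma sampled_integral_tendsto:
  fixes f :: "real \<Rightarrow> complex"
  assumes cont: "continuous_on UNIV f" and bd: "\<And>x. norm (f x) \<le> B"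
    and supp: "\<And>x. f x \<noteq> 0 \<Longrightarrow> \<bar>x\<bar> \<le> R"
  shows "(\<lambda>k. symbol (\<lambda>n. f (of_int n / real (Suc k))) 1 / of_nat (Suc k)) \<longlonglongrightarrow> (LINT x|lborel. f x)"
proof -
  define c where "c k n = f (of_int n / real (Suc k))" for k n
  define g where "g k x = interp (c k) (real (Suc k) * x)" for k x
  have fin: "finite {n. c k n \<noteq> 0}" for k
  proof (rule finite_subset)
    show "{n. c k n \<noteq> 0} \<subseteq> {- \<lceil>R * real (Suc k)\<rceil>..\<lceil>R * real (Suc k)\<rceil>}"
    proof
      fix n assume "n \<in> {n. c k n \<noteq> 0}"
      then have "\<bar>of_int n / real (Suc k)\<bar> \<le> R" by (intro supp) (simp add: c_def)
      then have "\<bar>real_of_int n\<bar> \<le> R * real (Suc k)"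
        by (simp add: abs_divide pos_divide_le_eq del: of_nat_Suc)
      then show "n \<in> {- \<lceil>R * real (Suc k)\<rceil>..\<lceil>R * real (Suc k)\<rceil>}"
        by (simp add: abs_le_iff del: of_nat_Suc) linarith
    qed
  qed simp
  have B: "0 \<le> B" using bd[of 0] norm_ge_zero order_trans by blast
  have geq: "g k x = of_real (1 - frac (real (Suc k) * x)) * f (of_int (\<lfloor>real (Suc k) * x\<rfloor> + 0) / real (Suc k))
      + of_real (frac (real (Suc k) * x)) * f (of_int (\<lfloor>real (Suc k) * x\<rfloor> + 1) / real (Suc k))" for k x
    unfolding g_def interp_floor[OF fin] c_def by simp
  have "(\<lambda>k. LINT x|lborel. g k x) \<longlonglongrightarrow> (LINT x|lborel. f x)"
  proof (rule integral_dominated_convergence[where w = "\<lambda>x. B * indicator {- (R + 1)..R + 1} x"])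
    show "f \<in> borel_measurable lborel"
      using cont by (simp add: borel_measurable_continuous_onI)
    show "g k \<in> borel_measurable lborel" for k
      using has_bochner_integral_interp[of "real (Suc k)" "c k"]
      by (auto simp: g_def[abs_def] has_bochner_integral_iff)
    show "integrable lborel (\<lambda>x. B * indicator {- (R + 1)..R + 1} x)"
      by (intro integrable_mult_right integrable_real_indicator) (auto simp: emeasure_lborel_Icc_eq)
    show "AE x in lborel. (\<lambda>k. g k x) \<longlonglongrightarrow> f x"
    proof (rule AE_I2)
      fix x
      have lim: "(\<lambda>k. f (of_int (\<lfloor>real (Suc k) * x\<rfloor> + i) / real (Suc k))) \<longlonglongrightarrow> f x" for i
        using cont by (intro isCont_tendsto_compose[OF _ floor_quotient_tendsto])
          (simp add: continuous_on_eq_continuous_at)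
      have "(\<lambda>k. g k x - f x) \<longlonglongrightarrow> 0"
      proof (rule Lim_null_comparison)
        show "(\<lambda>k. norm (f (of_int (\<lfloor>real (Suc k) * x\<rfloor> + 0) / real (Suc k)) - f x)
                 + norm (f (of_int (\<lfloor>real (Suc k) * x\<rfloor> + 1) / real (Suc k)) - f x)) \<longlonglongrightarrow> 0"
          using tendsto_add[OF tendsto_norm[OF LIM_zero[OF lim[of 0]]] tendsto_norm[OF LIM_zero[OF lim[of 1]]]]
          by simp
        show "\<forall>\<^sub>F k in sequentially. norm (g k x - f x) \<le>
            norm (f (of_int (\<lfloor>real (Suc k) * x\<rfloor> + 0) / real (Suc k)) - f x)
          + norm (f (of_int (\<lfloor>real (Suc k) * x\<rfloor> + 1) / real (Suc k)) - f x)"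
        proof (rule always_eventually, rule allI)
          fix k
          define t where "t = frac (real (Suc k) * x)"
          have t: "0 \<le> t" "t \<le> 1" by (auto simp: t_def frac_lt_1 less_imp_le)
          define u where "u = f (of_int (\<lfloor>real (Suc k) * x\<rfloor> + 0) / real (Suc k)) - f x"
          define v where "v = f (of_int (\<lfloor>real (Suc k) * x\<rfloor> + 1) / real (Suc k)) - f x"
          have "g k x - f x = of_real (1 - t) * u + of_real t * v"
            unfolding geq t_def[symmetric] u_def v_def by (simp add: algebra_simps)
          then have "norm (g k x - f x) \<le> (1 - t) * norm u + t * norm v"
            using norm_triangle_ineq[of "of_real (1 - t) * u" "of_real t * v"] t
            by (simp add: norm_mult del: of_real_diff)
          also have "\<dots> \<le> 1 * norm u + 1 * norm v"
            using t by (intro add_mono mult_right_mono) auto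
          finally show "norm (g k x - f x) \<le> norm u + norm v" by simp
        qed
      qed
      then show "(\<lambda>k. g k x) \<longlonglongrightarrow> f x" by (rule LIM_zero_cancel)
    qed
    show "AE x in lborel. norm (g k x) \<le> B * indicator {- (R + 1)..R + 1} x" for k
    proof (rule AE_I2)
      fix x
      show "norm (g k x) \<le> B * indicator {- (R + 1)..R + 1} x"
      proof (cases "g k x = 0")
        case True
        then show ?thesis using B by simp
      next
        case False
        then obtain n where n: "c k n \<noteq> 0" "\<bar>real (Suc k) * x - of_int n\<bar> < 1"
          unfolding g_def by (rule interp_nonzero)
        have "\<bar>of_int n / real (Suc k)\<bar> \<le> R" using n(1) by (intro supp) (simp add: c_def)
        moreover have "\<bar>x - of_int n / real (Suc k)\<bar> \<le> 1"
        proof -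
          have "\<bar>x - of_int n / real (Suc k)\<bar> = \<bar>real (Suc k) * x - of_int n\<bar> / real (Suc k)"
            using abs_divide[of "real (Suc k) * x - of_int n" "real (Suc k)"]
            by (simp add: diff_divide_distrib del: of_nat_Suc)
          also have "\<dots> \<le> 1" using n(2) by (simp add: pos_divide_le_eq)
          finally show ?thesis .
        qed
        ultimately have "x \<in> {- (R + 1)..R + 1}" unfolding atLeastAtMost_iff by linarith
        moreover have "norm (g k x) \<le> B"
        proof -
          define t where "t = frac (real (Suc k) * x)"
          have t: "0 \<le> t" "t \<le> 1" by (auto simp: t_def frac_lt_1 less_imp_le)
          have "norm (g k x) \<le> (1 - t) * norm (f (of_int (\<lfloor>real (Suc k) * x\<rfloor> + 0) / real (Suc k)))
             + t * norm (f (of_int (\<lfloor>real (Suc k) * x\<rfloor> + 1) / real (Suc k)))"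
            unfolding geq t_def[symmetric] using t
            by (intro order_trans[OF norm_triangle_ineq]) (simp add: norm_mult del: of_real_diff)
          also have "\<dots> \<le> (1 - t) * B + t * B"
            using t bd by (intro add_mono mult_left_mono) auto
          finally show ?thesis by (simp add: algebra_simps)
        qed
        ultimately show ?thesis by simp
      qed
    qed
  qed
  moreover have "(LINT x|lborel. g k x) = symbol (c k) 1 / of_nat (Suc k)" for k
    using has_bochner_integral_interp[of "real (Suc k)" "c k"]
    by (simp add: g_def has_bochner_integral_iff del: of_nat_Suc)
  ultimately show ?thesis by (simp add: c_def[abs_def] del: of_nat_Suc)
qed

text \<open>The samples \<open>f (n / N)\<close> are admissible once the margin of the support of \<open>f\<close> exceeds \<open>1 / N\<close>.\<close>

lemma turan_int_above_integral:
  assumes f: "turan_function (Omega lam) f" and y: "y < Re (LINT x|lborel. f x)"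
  shows "\<forall>\<^sub>F N in sequentially. y < (1 / real N) * turan_int (A_set N lam)"
proof -
  have pd: "positive_definite_real f" "f 0 = 1" and cont: "continuous_on UNIV f"
    and supp: "closed_support f \<subseteq> Omega lam"
    using f by (auto simp: turan_function_def)
  have in_supp: "x \<in> closed_support f" if "f x \<noteq> 0" for x
    unfolding closed_support_def using that closure_subset[of "{x. f x \<noteq> 0}"] by blast
  have "bounded (closed_support f)"
    using supp Omega_bounded bounded_closed_interval bounded_subset by (metis subset_trans)
  then have "compact (closed_support f)"
    by (simp add: compact_eq_bounded_closed closed_support_def)
  then obtain \<delta> where \<delta>: "0 < \<delta>" "\<And>x. x \<in> closed_support f \<Longrightarrow>
      \<bar>x\<bar> \<le> 1 - \<delta> \<or> \<bar>x - lam\<bar> \<le> 1 - \<delta> \<or> \<bar>x + lam\<bar> \<le> 1 - \<delta>"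
    using compact_in_Omega_margin[OF _ supp] by blast
  have "(\<lambda>k. Re (symbol (\<lambda>n. f (of_int n / real (Suc k))) 1 / of_nat (Suc k))) \<longlonglongrightarrow> Re (LINT x|lborel. f x)"
  proof (intro tendsto_Re sampled_integral_tendsto[OF cont, of 1 "\<bar>lam\<bar> + 1"])
    show "norm (f x) \<le> 1" for x using pd_real_bound[OF pd(1), of x] pd(2) by simp
    show "\<bar>x\<bar> \<le> \<bar>lam\<bar> + 1" if "f x \<noteq> 0" for x
      using in_supp[OF that] supp Omega_bounded[of lam] by (force simp: abs_le_iff)
  qed
  then have "\<forall>\<^sub>F k in sequentially. y < Re (symbol (\<lambda>n. f (of_int n / real (Suc k))) 1 / of_nat (Suc k))"
    using y by (rule order_tendstoD(1))
  moreover have "\<forall>\<^sub>F k in sequentially. 1 / \<delta> < real (Suc k)"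
    using filterlim_real_sequentially by (simp add: filterlim_at_top_dense eventually_sequentially_Suc[of "\<lambda>k. 1 / \<delta> < real k"] del: of_nat_Suc)
  ultimately have "\<forall>\<^sub>F k in sequentially. y < (1 / real (Suc k)) * turan_int (A_set (Suc k) lam)"
  proof eventually_elim
    case (elim k)
    define N where "N = Suc k"
    define c where "c n = f (of_int n / real N)" for n
    have N: "0 < real N" "1 \<le> \<delta> * real N"
      using elim(2) \<delta>(1) by (auto simp: N_def field_simps)
    have A: "n \<in> A_set N lam" if "c n \<noteq> 0" for n
    proof -
      have "\<bar>of_int n - real N * t\<bar> \<le> real N - 1" if "\<bar>of_int n / real N - t\<bar> \<le> 1 - \<delta>" for t
      proof -
        have "\<bar>of_int n - real N * t\<bar> = \<bar>of_int n / real N - t\<bar> * real N"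
          using N(1) by (simp add: abs_mult[symmetric] field_simps del: abs_mult)
        also have "\<dots> \<le> (1 - \<delta>) * real N" using that N(1) by (intro mult_right_mono) auto
        also have "\<dots> \<le> real N - 1" using N(2) by (simp add: algebra_simps)
        finally show ?thesis .
      qed
      note near = this[of 0] this[of lam] this[of "- lam"]
      have "of_int n / real N \<in> closed_support f" using that by (intro in_supp) (simp add: c_def)
      from \<delta>(2)[OF this] near show ?thesis
        unfolding A_set_def by (auto; linarith)
    qed
    have "turan_sequence (A_set N lam) c"
      using pd_real_sample[OF pd(1), of "1 / real N"] A pd(2)
      by (auto simp: turan_sequence_def c_def[abs_def])
    then have "Re (\<Sum>n\<in>A_set N lam. c n) \<le> turan_int (A_set N lam)" by (rule turan_int_upper)
    moreover have "(\<Sum>n\<in>A_set N lam. c n) = symbol c 1"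
      using A by (subst symbol_eq_sum[OF finite_A_set]) auto
    moreover have "y < Re (symbol c 1) / real N"
      using elim(1) by (simp add: c_def[abs_def] N_def Re_divide_of_nat del: of_nat_Suc)
    ultimately have "y < (1 / real N) * turan_int (A_set N lam)"
      using N(1) by (simp add: less_le_trans divide_right_mono)
    then show ?case by (simp add: N_def)
  qed
  then show ?thesis
    by (rule eventually_sequentially_Suc[of "\<lambda>N. y < (1 / real N) * turan_int (A_set N lam)", THEN iffD1])
qed

section \<open>Estimates for the kernels\<close>

definition dirichlet :: "nat \<Rightarrow> complex \<Rightarrow> complex" where
  "dirichlet L z = (\<Sum>j<L. z ^ j)"

lemma norm_dirichlet_le:
  assumes "norm z = 1"
  shows "norm (dirichlet L z) \<le> real L"
  using sum_norm_le[of "{..<L}" "\<lambda>j. z ^ j" "\<lambda>_. 1"] assms by (simp add: dirichlet_def norm_power)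

lemma norm_dirichlet_mult: "norm (dirichlet L z) * norm (z - 1) = norm (z ^ L - 1)"
  by (simp add: dirichlet_def power_diff_1_eq norm_mult mult.commute)

lemma norm_power_minus_1_le: "norm z = 1 \<Longrightarrow> norm (z ^ L - 1) \<le> 2" for z :: complex
  using norm_triangle_ineq4[of "z ^ L" 1] by (simp add: norm_power)

lemma norm_cis_minus_1_le: "norm (cis t - 1) \<le> \<bar>t\<bar>"
proof -
  have "norm (cis t - 1) = 2 * \<bar>sin (t / 2)\<bar>"
    using dist_exp_i_1[of t] by (simp add: cis_conv_exp)
  also have "\<dots> \<le> 2 * \<bar>t / 2\<bar>"
    using abs_sin_x_le_abs_x[of "t / 2"] by simp
  finally show ?thesis by simp
qed

text \<open>A single Fejer kernel has zeros.  The translate by half a period \<open>pi / N\<close> is large exactly there, so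
  the sum of the two is bounded below by a Poisson-like kernel.\<close>

definition majorant :: "nat \<Rightarrow> complex \<Rightarrow> real" where
  "majorant N u = ((norm (dirichlet N u))\<^sup>2 + (norm (dirichlet N (cis (pi / real N) * u)))\<^sup>2) / real N"

lemma majorant_nonneg: "0 \<le> majorant N u"
  by (simp add: majorant_def)

text \<open>The numerators of the two Fejer kernels are \<open>\<bar>u^N - 1\<bar>\<close> squared and \<open>\<bar>u^N + 1\<bar>\<close> squared, which add
  up to \<open>4\<close>, and both denominators are at most the square of \<open>\<bar>u - 1\<bar> + pi / N\<close>.\<close>

lemma majorant_lower_bound:
  assumes N: "0 < N" and u: "norm u = 1"
  shows "real N / 4 \<le> majorant N u * (1 + real N * norm (u - 1))\<^sup>2"
proof -
  define x where "x = real N * norm (u - 1)"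
  define r where "r = norm (u - 1) + pi / real N"
  define v where "v = cis (pi / real N) * u"
  have x: "0 \<le> x" by (simp add: x_def)
  have "v - 1 = cis (pi / real N) * (u - 1) + (cis (pi / real N) - 1)"
    by (simp add: v_def algebra_simps)
  then have "norm (v - 1) \<le> norm (u - 1) + norm (cis (pi / real N) - 1)"
    using norm_triangle_ineq[of "cis (pi / real N) * (u - 1)" "cis (pi / real N) - 1"]
    by (simp only: norm_mult norm_cis mult_1)
  then have v1: "norm (v - 1) \<le> r"
    using norm_cis_minus_1_le[of "pi / real N"] by (simp add: r_def)
  have vN: "v ^ N = - (u ^ N)"
    using N by (simp add: v_def power_mult_distrib Complex.DeMoivre)
  have "norm (u ^ N - 1) \<le> norm (dirichlet N u) * r"
    unfolding norm_dirichlet_mult[symmetric] by (intro mult_left_mono) (simp_all add: r_def)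
  then have 1: "(norm (u ^ N - 1))\<^sup>2 \<le> (norm (dirichlet N u) * r)\<^sup>2" by (intro power_mono) auto
  have "norm (v ^ N - 1) \<le> norm (dirichlet N v) * r"
    unfolding norm_dirichlet_mult[symmetric] by (intro mult_left_mono v1) simp
  moreover have "norm (v ^ N - 1) = norm (u ^ N + 1)"
    unfolding vN by (metis minus_add_distrib norm_minus_cancel uminus_add_conv_diff add.commute diff_conv_add_uminus)
  ultimately have 2: "(norm (u ^ N + 1))\<^sup>2 \<le> (norm (dirichlet N v) * r)\<^sup>2" by (intro power_mono) auto
  have "norm (u ^ N) = 1" using u by (simp add: norm_power)
  then have "(Re (u ^ N))\<^sup>2 + (Im (u ^ N))\<^sup>2 = 1" using cmod_power2[of "u ^ N"] by simp
  then have "(norm (u ^ N - 1))\<^sup>2 + (norm (u ^ N + 1))\<^sup>2 = 4"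
    unfolding cmod_power2 by (simp add: power2_eq_square algebra_simps)
  then have "4 \<le> ((norm (dirichlet N u))\<^sup>2 + (norm (dirichlet N v))\<^sup>2) * r\<^sup>2"
    using 1 2 by (simp add: power_mult_distrib distrib_right)
  also have "\<dots> = majorant N u * real N * r\<^sup>2"
    using N by (simp add: majorant_def v_def)
  also have "\<dots> = majorant N u * (x + pi)\<^sup>2 / real N"
    using N by (simp add: r_def x_def field_simps power2_eq_square)
  finally have "4 * real N \<le> majorant N u * (x + pi)\<^sup>2" using N by (simp add: field_simps)
  also have "\<dots> \<le> majorant N u * (4 * (1 + x))\<^sup>2"
    using x pi_less_4 majorant_nonneg by (intro mult_left_mono power_mono) auto
  also have "\<dots> = 16 * (majorant N u * (1 + x)\<^sup>2)"
    unfolding power_mult_distrib by simp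
  finally show ?thesis unfolding x_def by simp
qed

text \<open>A de la Vallee Poussin kernel: its coefficients are the indicator of an interval of length \<open>A\<close>,
  starting at \<open>N\<close>, convolved with two uniform distributions on \<open>B\<close> consecutive integers.  The two extra
  factors make it decay like the inverse third power of the distance to \<open>1\<close>.\<close>

definition plateau :: "nat \<Rightarrow> nat \<Rightarrow> nat \<Rightarrow> complex \<Rightarrow> complex" where
  "plateau N A B u = u ^ N * dirichlet A u * (dirichlet B u)\<^sup>2 / (of_nat B)\<^sup>2"

text \<open>With \<open>x = N \<bar>u - 1\<bar>\<close> the kernel is \<open>O(N / (1 + x)^3)\<close>, while the majorant is at least of order
  \<open>N / (1 + x)^2\<close>; one power of \<open>1 + x\<close> is gained.\<close>

lemma plateau_bound:
  assumes N: "0 < N" and B: "0 < B" and u: "norm u = 1"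
    and A_le: "real A \<le> a * real N" and B_ge: "b * real N \<le> real B" and b: "0 < b"
  shows "norm (plateau N A B u) * (1 + real N * norm (u - 1)) \<le> 16 * (a + 8 / b\<^sup>2) * majorant N u"
proof -
  define x where "x = real N * norm (u - 1)"
  define P where "P = norm (plateau N A B u)"
  have x: "0 \<le> x" by (simp add: x_def)
  have P: "P = norm (dirichlet A u) * (norm (dirichlet B u) / real B)\<^sup>2"
    using u by (simp add: P_def plateau_def norm_mult norm_divide norm_power power_divide)
  have dA1: "norm (dirichlet A u) \<le> a * real N"
    using norm_dirichlet_le[OF u, of A] A_le by simp
  have "norm (dirichlet A u) * x = real N * norm (u ^ A - 1)"
    using norm_dirichlet_mult[of A u] by (simp add: x_def mult.left_commute)
  also have "\<dots> \<le> real N * 2"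
    by (intro mult_left_mono norm_power_minus_1_le u) simp
  finally have dA2: "norm (dirichlet A u) * x \<le> 2 * real N" by simp
  note dA = dA1 dA2
  have dB1: "norm (dirichlet B u) / real B \<le> 1"
    using norm_dirichlet_le[OF u, of B] B by simp
  have "norm (dirichlet B u) / real B * x = real N / real B * norm (u ^ B - 1)"
    using norm_dirichlet_mult[of B u] by (simp add: x_def mult.left_commute field_simps)
  also have "\<dots> \<le> 1 / b * 2"
  proof (intro mult_mono norm_power_minus_1_le u)
    show "real N / real B \<le> 1 / b" using B_ge b B by (simp add: field_simps)
  qed (use b in auto)
  finally have dB2: "norm (dirichlet B u) / real B * x \<le> 2 / b" by simp
  have "P \<le> a * real N * 1"
    unfolding P using dB1 dA(1) by (intro mult_mono power_le_one) (auto intro: order_trans[OF norm_ge_zero])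
  moreover have "P * x ^ 3 = (norm (dirichlet A u) * x) * (norm (dirichlet B u) / real B * x)\<^sup>2"
    unfolding P by (simp add: power2_eq_square power3_eq_cube)
  moreover have "\<dots> \<le> (2 * real N) * (2 / b)\<^sup>2"
    using x by (intro mult_mono[OF dA2 power_mono[OF dB2]]) auto
  ultimately have PP: "P + P * x ^ 3 \<le> (a + 8 / b\<^sup>2) * real N"
    by (simp add: power_divide algebra_simps)
  have "(1 + x) ^ 3 \<le> 4 * (1 + x ^ 3)"
  proof -
    \<comment> \<open>The difference of the two sides factors.\<close>
    have "0 \<le> 3 * ((1 + x) * (1 - x)\<^sup>2)" using x by (intro mult_nonneg_nonneg) auto
    also have "\<dots> = 4 * (1 + x ^ 3) - (1 + x) ^ 3"
      by (simp add: power2_eq_square power3_eq_cube algebra_simps)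
    finally show ?thesis by simp
  qed
  then have "P * (1 + x) ^ 3 \<le> P * (4 * (1 + x ^ 3))" by (intro mult_left_mono) (simp_all add: P_def)
  also have "P * (4 * (1 + x ^ 3)) = 4 * (P + P * x ^ 3)" by (simp add: algebra_simps)
  also have "\<dots> \<le> 4 * ((a + 8 / b\<^sup>2) * real N)" using PP by (intro mult_left_mono) auto
  finally have 1: "P * (1 + x) ^ 3 \<le> 4 * (a + 8 / b\<^sup>2) * real N" by (simp only: mult.assoc)
  have "0 \<le> a" using A_le N by (metis mult_less_0_iff not_le of_nat_0_le_iff of_nat_0_less_iff order_trans)
  define Q where "Q = a + 8 / b\<^sup>2"
  have "0 \<le> Q" using \<open>0 \<le> a\<close> by (simp add: Q_def)
  then have "16 * Q * (real N / 4) \<le> 16 * Q * (majorant N u * (1 + x)\<^sup>2)"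
    using majorant_lower_bound[OF N u] unfolding x_def by (intro mult_left_mono) auto
  then have "4 * (a + 8 / b\<^sup>2) * real N \<le> 16 * (a + 8 / b\<^sup>2) * (majorant N u * (1 + x)\<^sup>2)"
    unfolding Q_def[symmetric] by simp
  with 1 have "(P * (1 + x)) * (1 + x)\<^sup>2 \<le> (16 * (a + 8 / b\<^sup>2) * majorant N u) * (1 + x)\<^sup>2"
    by (simp add: power2_eq_square power3_eq_cube mult.assoc)
  then have "P * (1 + x) \<le> 16 * (a + 8 / b\<^sup>2) * majorant N u"
    by (rule mult_right_le_imp_le) (use x in auto)
  then show ?thesis by (simp add: P_def x_def)
qed

definition fejer :: "nat \<Rightarrow> complex \<Rightarrow> real" where
  "fejer L z = (norm (dirichlet L z))\<^sup>2 / (real L)\<^sup>2"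

definition saturation :: "real \<Rightarrow> real" where "saturation y = y / (1 + y)"

text \<open>A bump concentrated where \<open>y\<close> is of order one.  It is written as a dyadic difference of a bounded
  increasing function in order that its sum over dyadic scales telescopes.\<close>

definition window :: "real \<Rightarrow> real" where "window y = saturation (2 * y) - saturation y"

lemma saturation_bounds: "0 \<le> y \<Longrightarrow> 0 \<le> saturation y \<and> saturation y \<le> 1"
  by (simp add: saturation_def)

lemma saturation_mono: "0 \<le> x \<Longrightarrow> x \<le> y \<Longrightarrow> saturation x \<le> saturation y"
  by (simp add: saturation_def field_simps)

lemma saturation_lipschitz: "0 \<le> x \<Longrightarrow> x \<le> y \<Longrightarrow> saturation y - saturation x \<le> y - x"
proof -
  assume x: "0 \<le> x" "x \<le> y"
  have "saturation y - saturation x = (y - x) / ((1 + x) * (1 + y))"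
    using x by (simp add: saturation_def field_simps)
  also have "\<dots> \<le> (y - x) / 1"
    using x mult_mono[of 1 "1 + x" 1 "1 + y"] by (intro divide_left_mono) auto
  finally show ?thesis by simp
qed

lemma window_nonneg: "0 \<le> y \<Longrightarrow> 0 \<le> window y"
  using saturation_mono[of y "2 * y"] by (simp add: window_def)

lemma window_eq: "0 \<le> y \<Longrightarrow> window y = y / ((1 + y) * (1 + 2 * y))"
  by (simp add: window_def saturation_def field_simps)

lemma window_lipschitz:
  assumes "0 \<le> x" "0 \<le> y"
  shows "window y \<le> window x + 2 * \<bar>y - x\<bar>"
proof (cases "x \<le> y")
  case True
  then show ?thesis using assms saturation_lipschitz[of "2 * x" "2 * y"] saturation_mono[of x y] by (simp add: window_def)
next
  case False
  then show ?thesis using assms saturation_lipschitz[of y x] saturation_mono[of "2 * y" "2 * x"] by (simp add: window_def)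
qed

lemma sum_window_dyadic:
  assumes "0 \<le> x"
  shows "(\<Sum>j<J. window (2 ^ j * x)) \<le> 1"
proof -
  have "(\<Sum>j<J. window (2 ^ j * x)) = (\<Sum>j<J. saturation (2 ^ Suc j * x) - saturation (2 ^ j * x))"
    by (simp add: window_def mult.assoc)
  also have "\<dots> = saturation (2 ^ J * x) - saturation x"
    using sum_lessThan_telescope[of "\<lambda>j. saturation (2 ^ j * x)" J] by simp
  also have "\<dots> \<le> 1"
    using saturation_bounds[of "2 ^ J * x"] saturation_bounds[of x] assms by simp
  finally show ?thesis .
qed

text \<open>The factor gained in \<open>plateau_bound\<close> pays for moving the argument of the window from \<open>z\<close> to \<open>w\<close>, up to an
  error \<open>2 L / N\<close>.\<close>

lemma window_shift:
  assumes N: "0 < N"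
  shows "window (real L * norm (z - 1)) \<le>
    (window (real L * norm (w - 1)) + 2 * real L / real N) * (1 + real N * norm (z - w))"
proof -
  define d where "d = norm (z - w)"
  have "\<bar>norm (z - 1) - norm (w - 1)\<bar> \<le> d"
    using norm_triangle_ineq3[of "z - 1" "w - 1"] by (simp add: d_def)
  then have "\<bar>real L * norm (z - 1) - real L * norm (w - 1)\<bar> \<le> real L * d"
    by (simp add: right_diff_distrib[symmetric] abs_mult mult_left_mono)
  then have "window (real L * norm (z - 1)) \<le> window (real L * norm (w - 1)) + 2 * (real L * d)"
    using window_lipschitz[of "real L * norm (w - 1)" "real L * norm (z - 1)"] by simp
  also have "\<dots> \<le> window (real L * norm (w - 1)) + 2 * real L / real N
      + (window (real L * norm (w - 1)) * (real N * d) + 2 * (real L * d))"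
    using window_nonneg[of "real L * norm (w - 1)"] by (simp add: d_def)
  also have "\<dots> = (window (real L * norm (w - 1)) + 2 * real L / real N) * (1 + real N * d)"
    using N by (simp add: field_simps)
  finally show ?thesis by (simp add: d_def)
qed

text \<open>If \<open>L \<bar>z - 1\<bar> \<le> 1\<close>, then \<open>\<bar>z^s - 1\<bar> \<le> s \<bar>z - 1\<bar>\<close> is small; otherwise the Fejer kernel is at most
  \<open>4 / (L \<bar>z - 1\<bar>)^2\<close>.  In both ranges the window has the same order of magnitude as the bound
  obtained.\<close>

lemma fejer_phase_bound:
  assumes L: "0 < L" and s: "real s \<le> k * real L" and z: "norm z = 1"
  shows "fejer L z * (2 * norm (z ^ s - 1)) \<le> (12 * k + 96) * window (real L * norm (z - 1))"
proof -
  define y where "y = real L * norm (z - 1)"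
  have y: "0 \<le> y" by (simp add: y_def)
  have k: "0 \<le> k" using s L by (metis mult_less_0_iff not_le of_nat_0_le_iff of_nat_0_less_iff order_trans)
  have f0: "0 \<le> fejer L z" by (simp add: fejer_def)
  have f1: "fejer L z \<le> 1"
    using norm_dirichlet_le[OF z, of L] L by (simp add: fejer_def power_mono)
  have w: "0 \<le> window y" by (rule window_nonneg[OF y])
  show ?thesis
  proof (cases "y \<le> 1")
    case True
    have "norm (z ^ s - 1) \<le> real s * norm (z - 1)"
      unfolding norm_dirichlet_mult[symmetric] by (intro mult_right_mono norm_dirichlet_le z) simp
    also have "\<dots> \<le> k * y" using s mult_right_mono[OF s, of "norm (z - 1)"] by (simp add: y_def)
    finally have "fejer L z * (2 * norm (z ^ s - 1)) \<le> 1 * (2 * (k * y))"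
      using f0 f1 by (intro mult_mono) auto
    also have "\<dots> = 12 * k * (y / 6)" by simp
    also have "y / 6 \<le> window y"
      unfolding window_eq[OF y] using y True mult_mono[of "1 + y" 2 "1 + 2 * y" 3]
      by (intro divide_left_mono) auto
    finally show ?thesis using k w by (simp add: y_def[symmetric] distrib_right mult_left_mono)
  next
    case False
    have "fejer L z * y\<^sup>2 = (norm (dirichlet L z) * norm (z - 1))\<^sup>2"
      using L by (simp add: fejer_def y_def power_mult_distrib)
    also have "\<dots> \<le> 2\<^sup>2"
      unfolding norm_dirichlet_mult by (intro power_mono norm_power_minus_1_le z) simp
    finally have "fejer L z \<le> 4 / y\<^sup>2" using False by (simp add: field_simps)
    then have "fejer L z * (2 * norm (z ^ s - 1)) \<le> 4 / y\<^sup>2 * (2 * 2)"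
      using f0 norm_power_minus_1_le[OF z, of s] by (intro mult_mono) auto
    also have "\<dots> \<le> 96 * (y / (6 * y\<^sup>2))" using False by (simp add: field_simps)
    also have "y / (6 * y\<^sup>2) \<le> window y"
      unfolding window_eq[OF y] using False mult_mono[of "1 + y" "2 * y" "1 + 2 * y" "3 * y"]
      by (intro divide_left_mono) (auto simp: power2_eq_square)
    finally show ?thesis using k w by (simp add: y_def[symmetric] distrib_right add_increasing)
  qed
qed

section \<open>Sequences that realise the kernels\<close>

text \<open>A modulus for which discrete Fourier inversion at roots of unity is exact for all frequencies in
  \<open>S\<close>.\<close>

lemma exists_separating_modulus:
  fixes S :: "int set"
  assumes "finite S"
  obtains M where "0 < M" "\<And>m n. m \<in> S \<Longrightarrow> n \<in> S \<Longrightarrow> int M dvd m - n \<Longrightarrow> m = n"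
proof -
  define R where "R = Max (abs ` insert 0 S)"
  have R: "\<bar>n\<bar> \<le> R" if "n \<in> insert 0 S" for n
    unfolding R_def using assms that by (intro Max_ge) auto
  have R0: "0 \<le> R" using R[of 0] by simp
  have "m = n" if "m \<in> S" "n \<in> S" "int (nat (2 * R + 1)) dvd m - n" for m n
  proof (rule ccontr)
    assume "m \<noteq> n"
    then have "int (nat (2 * R + 1)) \<le> \<bar>m - n\<bar>"
      using dvd_imp_le_int[OF _ that(3)] by simp
    then show False using R[of m] R[of n] that R0 by simp
  qed
  then show ?thesis using that[of "nat (2 * R + 1)"] R0 by simp
qed

text \<open>Multiplying coefficients is convolving symbols; the convolution is exact on a grid of roots of unity
  whose order separates the frequencies.\<close>

lemma symbol_product:
  assumes M: "0 < M" and c: "finite {n. c n \<noteq> 0}" and v: "finite {n. v n \<noteq> 0}"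
    and sep: "\<And>m n. c m \<noteq> 0 \<Longrightarrow> v n \<noteq> 0 \<Longrightarrow> int M dvd m - n \<Longrightarrow> m = n"
  shows "symbol (\<lambda>n. v n * c n) z =
    (\<Sum>k<M. symbol c (unity_root M k) * symbol v (z / unity_root M k)) / of_nat M"
proof -
  have nz: "unity_root M k \<noteq> 0" for k by (simp add: unity_root_def)
  have "symbol (\<lambda>n. v n * c n) z = (\<Sum>n | v n \<noteq> 0. v n * z powi n * c n)"
    using v by (subst symbol_eq_sum[of "{n. v n \<noteq> 0}"]) (auto simp: mult_ac)
  also have "\<dots> = (\<Sum>n | v n \<noteq> 0. v n * z powi n *
      ((\<Sum>k<M. symbol c (unity_root M k) * unity_root M k powi (- n)) / of_nat M))"
    using M sep by (intro sum.cong refl) (simp add: symbol_inversion[OF M c])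
  also have "\<dots> = (\<Sum>n | v n \<noteq> 0. \<Sum>k<M. symbol c (unity_root M k) * (v n * (z / unity_root M k) powi n) / of_nat M)"
    by (simp add: sum_distrib_left sum_divide_distrib power_int_divide_distrib power_int_minus nz field_simps)
  also have "\<dots> = (\<Sum>k<M. symbol c (unity_root M k) * symbol v (z / unity_root M k)) / of_nat M"
    by (subst sum.swap) (simp add: symbol_def sum_distrib_left sum_divide_distrib)
  finally show ?thesis .
qed

definition fejer_seq :: "nat \<Rightarrow> int \<Rightarrow> complex" where
  "fejer_seq N n = (\<Sum>a<N. \<Sum>b<N. impulse (int a - int b) n)"

lemma finite_support_fejer_seq: "finite {n. fejer_seq N n \<noteq> 0}"
  unfolding fejer_seq_def by (intro finite_support_sum finite_support_impulse) simp_all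

lemma unit_powi_diff_mult:
  assumes "norm z = 1"
  shows "z powi (int a - int b) = z ^ a * cnj (z ^ b)"
proof -
  have "z \<noteq> 0" using assms by auto
  then show ?thesis using assms by (simp add: power_int_diff cnj_unit field_simps)
qed

lemma sum_powi_diff:
  assumes "norm z = 1"
  shows "(\<Sum>a<L. \<Sum>b<L. z powi (int a - int b)) = of_real ((norm (dirichlet L z))\<^sup>2)"
proof -
  have "(\<Sum>a<L. \<Sum>b<L. z powi (int a - int b)) = dirichlet L z * cnj (dirichlet L z)"
    unfolding dirichlet_def cnj_sum sum_product
    by (intro sum.cong refl unit_powi_diff_mult assms)
  then show ?thesis by (simp only: complex_norm_square)
qed

lemma symbol_fejer_seq:
  assumes "norm z = 1"
  shows "symbol (fejer_seq N) z = of_real ((norm (dirichlet N z))\<^sup>2)"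
proof -
  have "symbol (fejer_seq N) z = (\<Sum>a<N. \<Sum>b<N. z powi (int a - int b))"
    unfolding fejer_seq_def
    by (simp add: symbol_sum finite_support_sum finite_support_impulse symbol_impulse)
  then show ?thesis by (simp only: sum_powi_diff[OF assms])
qed

lemma fejer_seq_0: "fejer_seq N 0 = of_nat N"
proof -
  have "(\<Sum>b<N. impulse (int a - int b) 0) = 1" if "a < N" for a
    using that by (simp add: impulse_def sum.delta eq_commute[of 0])
  then show ?thesis by (simp add: fejer_seq_def)
qed

lemma fejer_seq_eq_0: "int N \<le> \<bar>n\<bar> \<Longrightarrow> fejer_seq N n = 0"
  unfolding fejer_seq_def by (intro sum.neutral ballI) (auto simp: impulse_def)

definition majorant_seq :: "nat \<Rightarrow> int \<Rightarrow> complex" where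
  "majorant_seq N n = of_real (1 / real N) * (fejer_seq N n + cis (pi / real N) powi n * fejer_seq N n)"

lemma finite_support_majorant_seq: "finite {n. majorant_seq N n \<noteq> 0}"
  by (rule finite_subset[OF _ finite_support_fejer_seq[of N]]) (auto simp: majorant_seq_def)

lemma symbol_majorant_seq:
  assumes "norm z = 1"
  shows "symbol (majorant_seq N) z = of_real (majorant N z)"
proof -
  have "symbol (majorant_seq N) z = of_real (1 / real N) *
     (symbol (fejer_seq N) z + symbol (fejer_seq N) (cis (pi / real N) * z))"
    unfolding majorant_seq_def symbol_cmult
    by (subst symbol_add) (simp_all add: finite_support_fejer_seq finite_support_mult symbol_modulate)
  also have "\<dots> = of_real (majorant N z)"
    using assms by (simp add: symbol_fejer_seq norm_mult majorant_def)
  finally show ?thesis .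
qed

lemma majorant_seq_0: "0 < N \<Longrightarrow> majorant_seq N 0 = 2"
  by (simp add: majorant_seq_def fejer_seq_0)

lemma majorant_seq_eq_0: "int N \<le> \<bar>n\<bar> \<Longrightarrow> majorant_seq N n = 0"
  by (simp add: majorant_seq_def fejer_seq_eq_0)

definition plateau_seq :: "nat \<Rightarrow> nat \<Rightarrow> nat \<Rightarrow> int \<Rightarrow> complex" where
  "plateau_seq N A B n =
     of_real (1 / (real B)\<^sup>2) * (\<Sum>i<A. \<Sum>a<B. \<Sum>b<B. impulse (int (N + i + a + b)) n)"

lemma finite_support_plateau_seq: "finite {n. plateau_seq N A B n \<noteq> 0}"
  unfolding plateau_seq_def
  by (intro finite_support_mult finite_support_sum finite_support_impulse) simp_all

lemma symbol_plateau_seq: "symbol (plateau_seq N A B) z = plateau N A B z"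
proof -
  have "symbol (plateau_seq N A B) z
      = of_real (1 / (real B)\<^sup>2) * (\<Sum>i<A. \<Sum>a<B. \<Sum>b<B. z ^ (N + i + a + b))"
    unfolding plateau_seq_def symbol_cmult
    by (simp add: symbol_sum finite_support_sum finite_support_impulse symbol_impulse)
       (simp flip: of_nat_add)
  also have "(\<Sum>i<A. \<Sum>a<B. \<Sum>b<B. z ^ (N + i + a + b)) = z ^ N * dirichlet A z * (dirichlet B z)\<^sup>2"
  proof -
    have "z ^ N * (dirichlet A z * (dirichlet B z * dirichlet B z))
        = (\<Sum>i<A. \<Sum>a<B. \<Sum>b<B. z ^ N * (z ^ i * (z ^ a * z ^ b)))"
      unfolding dirichlet_def unfolding sum_product unfolding sum_distrib_left ..
    then show ?thesis by (simp add: power_add power2_eq_square mult.assoc)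
  qed
  finally show ?thesis by (simp add: plateau_def)
qed

lemma plateau_seq_below: "n < int N \<Longrightarrow> plateau_seq N A B n = 0"
  unfolding plateau_seq_def by (simp add: impulse_def)

text \<open>On the plateau every shift \<open>a + b\<close> leaves \<open>n\<close> in the interval of length \<open>A\<close>.\<close>

lemma plateau_seq_flat:
  assumes B: "0 < B" and n: "int N + 2 * int B - 2 \<le> n" "n < int N + int A"
  shows "plateau_seq N A B n = 1"
proof -
  have "(\<Sum>i<A. impulse (int (N + i + a + b)) n) = 1" if "a < B" "b < B" for a b
  proof -
    have "impulse (int (N + i + a + b)) n = (if i = nat (n - int N - int a - int b) then 1 else 0)" for i
      using n that by (auto simp: impulse_def)
    moreover have "nat (n - int N - int a - int b) < A" using n that by simp
    ultimately show ?thesis by simp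
  qed
  then have "(\<Sum>a<B. \<Sum>b<B. \<Sum>i<A. impulse (int (N + i + a + b)) n) = of_nat B * of_nat B"
    by simp
  moreover have "(\<Sum>i<A. \<Sum>a<B. \<Sum>b<B. impulse (int (N + i + a + b)) n)
      = (\<Sum>a<B. \<Sum>b<B. \<Sum>i<A. impulse (int (N + i + a + b)) n)"
    by (rule trans[OF sum.swap], rule sum.cong[OF refl], rule sum.swap)
  ultimately show ?thesis using B by (simp add: plateau_seq_def power2_eq_square)
qed

text \<open>The coefficients of the symbol of \<open>d\<close> multiplied by the Fejer kernel normalised to be \<open>1\<close> at \<open>1\<close>.\<close>

definition smooth :: "nat \<Rightarrow> (int \<Rightarrow> complex) \<Rightarrow> int \<Rightarrow> complex" where
  "smooth L d n = of_real (1 / (real L)\<^sup>2) * (\<Sum>a<L. \<Sum>b<L. d (n - (int a - int b)))"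

lemma finite_support_smooth: "finite {n. d n \<noteq> 0} \<Longrightarrow> finite {n. smooth L d n \<noteq> 0}"
  unfolding smooth_def
  by (intro finite_support_mult finite_support_sum finite_support_shift) simp_all

lemma symbol_smooth:
  assumes "norm z = 1" "finite {n. d n \<noteq> 0}"
  shows "symbol (smooth L d) z = of_real (fejer L z) * symbol d z"
proof -
  have z0: "z \<noteq> 0" using assms(1) by auto
  have "symbol (smooth L d) z = of_real (1 / (real L)\<^sup>2) * ((\<Sum>a<L. \<Sum>b<L. z powi (int a - int b)) * symbol d z)"
    unfolding smooth_def symbol_cmult
    using assms(2) z0
    by (simp add: symbol_sum finite_support_sum finite_support_shift symbol_shift sum_distrib_right)
  then show ?thesis unfolding sum_powi_diff[OF assms(1)] by (simp add: fejer_def)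
qed

lemma smooth_nonzero:
  assumes "smooth L d n \<noteq> 0"
  obtains m where "d m \<noteq> 0" "\<bar>n - m\<bar> \<le> int L - 1"
proof -
  have "(\<Sum>a<L. \<Sum>b<L. d (n - (int a - int b))) \<noteq> 0" using assms by (auto simp: smooth_def)
  then obtain a where a: "a \<in> {..<L}" "(\<Sum>b<L. d (n - (int a - int b))) \<noteq> 0"
    by (rule sum.not_neutral_contains_not_neutral)
  from a(2) obtain b where b: "b \<in> {..<L}" "d (n - (int a - int b)) \<noteq> 0"
    by (rule sum.not_neutral_contains_not_neutral)
  show ?thesis using a(1) b by (intro that[of "n - (int a - int b)"]) auto
qed

lemma norm_smooth_le:
  assumes L: "0 < L" and d: "\<And>m. \<bar>n - m\<bar> < int L \<Longrightarrow> norm (d m) \<le> 1"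
  shows "norm (smooth L d n) \<le> 1"
proof -
  have "norm (\<Sum>a<L. \<Sum>b<L. d (n - (int a - int b))) \<le> (\<Sum>a<L. \<Sum>b<L. 1)"
    by (intro sum_norm_le d) auto
  then have "norm (\<Sum>a<L. \<Sum>b<L. d (n - (int a - int b))) \<le> (real L)\<^sup>2"
    by (simp add: power2_eq_square)
  then have "norm (\<Sum>a<L. \<Sum>b<L. d (n - (int a - int b))) / (real L)\<^sup>2 \<le> 1"
    using L by simp
  then show ?thesis by (simp add: smooth_def norm_mult norm_divide norm_power)
qed

section \<open>Dominating the error of a block translation\<close>

lemma A_set_cases:
  assumes "lam > 2" "n \<in> A_set N lam"
  shows "\<bar>n\<bar> < int N \<or> (int N \<le> n \<and> \<bar>of_int n - real N * lam\<bar> \<le> real N - 1)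
     \<or> (n \<le> - int N \<and> \<bar>of_int n + real N * lam\<bar> \<le> real N - 1)"
proof -
  have "real N * 2 \<le> real N * lam" using assms(1) by (intro mult_left_mono) auto
  then have "int N \<le> n" if "\<bar>of_int n - real N * lam\<bar> \<le> real N - 1" using that by linarith
  moreover have "n \<le> - int N" if "\<bar>of_int n + real N * lam\<bar> \<le> real N - 1"
    using that \<open>real N * 2 \<le> real N * lam\<close> by linarith
  ultimately show ?thesis using assms(2) unfolding A_set_def by auto
qed

definition right_part :: "nat \<Rightarrow> (int \<Rightarrow> complex) \<Rightarrow> int \<Rightarrow> complex" where
  "right_part N c n = (if int N \<le> n then c n else 0)"

definition plateau_length :: "nat \<Rightarrow> real \<Rightarrow> nat" where
  "plateau_length N lam = nat \<lceil>real N * lam\<rceil>"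

definition plateau_slope :: "nat \<Rightarrow> real \<Rightarrow> nat" where
  "plateau_slope N lam = nat \<lceil>real N * ((lam - 2) / 2)\<rceil>"

definition block_cutoff :: "nat \<Rightarrow> real \<Rightarrow> int \<Rightarrow> complex" where
  "block_cutoff N lam = plateau_seq N (plateau_length N lam) (plateau_slope N lam)"

text \<open>The right block lies between \<open>N (lam - 1)\<close> and \<open>N (lam + 1)\<close>, and the gap between it and the central block
  has length \<open>N (lam - 2)\<close>.  This leaves room for a slope of length about \<open>N (lam - 2) / 2\<close> for each
  of the two averaging factors.\<close>

lemma right_part_eq_cutoff:
  assumes lam: "lam > 2" and N: "0 < N" and c: "turan_sequence (A_set N lam) c"
  shows "right_part N c n = block_cutoff N lam n * c n"
proof (cases "int N \<le> n \<and> c n \<noteq> 0")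
  case True
  then have "n \<in> A_set N lam" using c by (auto simp: turan_sequence_def)
  then have n: "\<bar>of_int n - real N * lam\<bar> \<le> real N - 1"
    using A_set_cases[OF lam, of n N] True N by auto
  have B0: "0 < real N * ((lam - 2) / 2)" using lam N by simp
  have "real (plateau_slope N lam) < real N * ((lam - 2) / 2) + 1"
    unfolding plateau_slope_def using B0 by linarith
  then have "2 * real (plateau_slope N lam) < real N * lam - 2 * real N + 2"
    by (simp add: field_simps)
  then have "int N + 2 * int (plateau_slope N lam) - 2 \<le> n" using n by linarith
  moreover have "real N * lam \<le> real (plateau_length N lam)"
    unfolding plateau_length_def by linarith
  then have "n < int N + int (plateau_length N lam)" using n by linarith
  moreover have "0 < plateau_slope N lam" using B0 by (simp add: plateau_slope_def)
  ultimately show ?thesis using True by (simp add: right_part_def block_cutoff_def plateau_seq_flat)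
next
  case False
  then show ?thesis by (auto simp: right_part_def block_cutoff_def plateau_seq_below)
qed

definition cutoff_const :: "real \<Rightarrow> real" where
  "cutoff_const lam = 16 * ((lam + 1) + 8 / ((lam - 2) / 2)\<^sup>2)"

lemma cutoff_const_nonneg: "lam > 2 \<Longrightarrow> 0 \<le> cutoff_const lam"
  by (simp add: cutoff_const_def)

lemma symbol_block_cutoff_bound:
  assumes lam: "lam > 2" and N: "0 < N" and u: "norm u = 1"
  shows "norm (symbol (block_cutoff N lam) u) * (1 + real N * norm (u - 1)) \<le> cutoff_const lam * majorant N u"
  unfolding block_cutoff_def symbol_plateau_seq cutoff_const_def
proof (rule plateau_bound[OF N _ u])
  have B0: "0 < real N * ((lam - 2) / 2)" using lam N by simp
  then show "0 < plateau_slope N lam" by (simp add: plateau_slope_def)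
  show "(lam - 2) / 2 * real N \<le> real (plateau_slope N lam)"
    unfolding plateau_slope_def by (subst mult.commute) linarith
  have "0 \<le> real N * lam" using lam by simp
  then have "real (plateau_length N lam) \<le> real N * lam + 1" unfolding plateau_length_def by linarith
  also have "\<dots> \<le> (lam + 1) * real N" using N by (simp add: algebra_simps)
  finally show "real (plateau_length N lam) \<le> (lam + 1) * real N" .
qed (use lam in simp)

text \<open>The frequency \<open>0\<close> is included to make the mean of the symbol computable on the grid as well.\<close>

definition frequencies :: "nat \<Rightarrow> real \<Rightarrow> int set" where
  "frequencies N lam = insert 0 (A_set N lam \<union> {n. block_cutoff N lam n \<noteq> 0})"

definition separates :: "nat \<Rightarrow> nat \<Rightarrow> real \<Rightarrow> bool" where
  "separates M N lam \<longleftrightarrow> 0 < M \<and>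
    (\<forall>m\<in>frequencies N lam. \<forall>n\<in>frequencies N lam. int M dvd m - n \<longrightarrow> m = n)"

lemma separatesD:
  assumes "separates M N lam" "turan_sequence (A_set N lam) c" "c m \<noteq> 0"
    "n = 0 \<or> block_cutoff N lam n \<noteq> 0" "int M dvd m - n"
  shows "m = n"
proof -
  have "m \<in> A_set N lam" using assms(2,3) unfolding turan_sequence_def by metis
  then have "m \<in> frequencies N lam" "n \<in> frequencies N lam"
    using assms(4) by (auto simp: frequencies_def)
  then show ?thesis using assms(1,5) unfolding separates_def by metis
qed

lemma separates_exists:
  obtains M where "separates M N lam"
proof -
  have "finite (frequencies N lam)"
    using finite_A_set finite_support_plateau_seq by (simp add: block_cutoff_def frequencies_def)
  from exists_separating_modulus[OF this] obtain M where "separates M N lam"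
    unfolding separates_def by metis
  then show ?thesis by (rule that)
qed

lemma turan_sequence_finite_support:
  assumes "turan_sequence (A_set N lam) c"
  shows "finite {n. c n \<noteq> 0}"
  using assms by (intro finite_support_subset[OF finite_A_set]) (auto simp: turan_sequence_def)

lemma turan_sequence_symbol:
  assumes "turan_sequence (A_set N lam) c" "norm z = 1"
  shows "symbol c z = of_real (Re (symbol c z))" "0 \<le> Re (symbol c z)"
proof -
  have pd: "positive_definite_int c" using assms(1) by (simp only: turan_sequence_def)
  have "symbol c z \<in> \<real>\<^sub>\<ge>\<^sub>0"
    by (rule symbol_nonneg[OF pd turan_sequence_finite_support[OF assms(1)] assms(2)])
  then show "symbol c z = of_real (Re (symbol c z))" "0 \<le> Re (symbol c z)"
    by (auto simp: complex_nonneg_Reals_iff complex_eq_iff)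
qed

text \<open>The probability weights that the symbol of \<open>c\<close> induces on the \<open>M\<close>-th roots of unity.\<close>

definition spectral_weight :: "(int \<Rightarrow> complex) \<Rightarrow> nat \<Rightarrow> nat \<Rightarrow> real" where
  "spectral_weight c M k = Re (symbol c (unity_root M k)) / real M"

lemma spectral_weight_nonneg: "turan_sequence (A_set N lam) c \<Longrightarrow> 0 \<le> spectral_weight c M k"
  unfolding spectral_weight_def
  by (intro divide_nonneg_nonneg turan_sequence_symbol(2)[of N lam]) simp_all

lemma sum_spectral_weight:
  assumes c: "turan_sequence (A_set N lam) c" and M: "separates M N lam"
  shows "(\<Sum>k<M. spectral_weight c M k) = 1"
proof -
  have M0: "0 < M" using M by (simp add: separates_def)
  have "m = 0" if "c m \<noteq> 0" "int M dvd m - 0" for m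
    using separatesD[OF M c that(1) _ that(2)] by simp
  then have "(\<Sum>k<M. symbol c (unity_root M k) * unity_root M k powi (- 0)) = of_nat M * c 0"
    by (intro symbol_inversion[OF M0 turan_sequence_finite_support[OF c]]) auto
  then have "(\<Sum>k<M. symbol c (unity_root M k)) = of_nat M"
    using c by (simp add: turan_sequence_def)
  from arg_cong[OF this, of Re] show ?thesis
    using M0 by (simp add: spectral_weight_def sum_divide_distrib[symmetric])
qed

text \<open>The symbol of the right block is the convolution of the spectral weights with the cutoff kernel.  The
  weights are nonnegative, so the pointwise kernel bound carries over.\<close>

lemma norm_symbol_right_part:
  assumes lam: "lam > 2" and N: "0 < N" and c: "turan_sequence (A_set N lam) c"
    and M: "separates M N lam" and z: "norm z = 1"
  shows "norm (symbol (right_part N c) z) \<le> (\<Sum>k<M. spectral_weight c M k *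
      (cutoff_const lam * majorant N (z / unity_root M k) / (1 + real N * norm (z - unity_root M k))))"
proof -
  define w where "w = unity_root M"
  have w: "norm (w k) = 1" "w k \<noteq> 0" for k by (simp_all add: w_def unity_root_def)
  have M0: "0 < M" using M by (simp add: separates_def)
  have "right_part N c = (\<lambda>n. block_cutoff N lam n * c n)"
    by (intro ext right_part_eq_cutoff[OF lam N c])
  then have "symbol (right_part N c) z = symbol (\<lambda>n. block_cutoff N lam n * c n) z"
    by (rule arg_cong)
  also have "\<dots> = (\<Sum>k<M. symbol c (w k) * symbol (block_cutoff N lam) (z / w k)) / of_nat M"
    unfolding w_def
  proof (rule symbol_product[OF M0 turan_sequence_finite_support[OF c]])
    show "finite {n. block_cutoff N lam n \<noteq> 0}"
      by (simp add: block_cutoff_def finite_support_plateau_seq)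
    show "m = n" if "c m \<noteq> 0" "block_cutoff N lam n \<noteq> 0" "int M dvd m - n" for m n
      using separatesD[OF M c that(1) _ that(3)] that(2) by simp
  qed
  also have "\<dots> = (\<Sum>k<M. of_real (spectral_weight c M k) * symbol (block_cutoff N lam) (z / w k))"
    unfolding sum_divide_distrib
    by (intro sum.cong refl, subst turan_sequence_symbol(1)[OF c w(1)])
       (simp add: spectral_weight_def w_def)
  finally have "norm (symbol (right_part N c) z)
      \<le> (\<Sum>k<M. norm (of_real (spectral_weight c M k) * symbol (block_cutoff N lam) (z / w k)))"
    by (simp only: norm_sum)
  also have "\<dots> \<le> (\<Sum>k<M. spectral_weight c M k *
      (cutoff_const lam * majorant N (z / w k) / (1 + real N * norm (z - w k))))"
  proof (rule sum_mono)
    fix k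
    have u: "norm (z / w k) = 1" using z w by (simp add: norm_divide)
    have "z / w k - 1 = (z - w k) / w k" using w(2)[of k] by (simp add: field_simps)
    then have d: "norm (z / w k - 1) = norm (z - w k)" using w(1)[of k] by (simp add: norm_divide)
    have "0 < 1 + real N * norm (z - w k)" by (simp add: add_pos_nonneg)
    then have "norm (symbol (block_cutoff N lam) (z / w k))
        \<le> cutoff_const lam * majorant N (z / w k) / (1 + real N * norm (z - w k))"
      using symbol_block_cutoff_bound[OF lam N u] by (simp add: d pos_le_divide_eq)
    then show "norm (of_real (spectral_weight c M k) * symbol (block_cutoff N lam) (z / w k))
      \<le> spectral_weight c M k * (cutoff_const lam * majorant N (z / w k) / (1 + real N * norm (z - w k)))"
      using spectral_weight_nonneg[OF c, of M k] mult_left_mono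
      by (simp only: norm_mult norm_of_real abs_of_nonneg)
  qed
  finally show ?thesis by (simp add: w_def)
qed

definition phase_const :: "real \<Rightarrow> real" where
  "phase_const lam = 12 * (lam + 1) + 96"

text \<open>The size, up to constants, of the translation error produced by the part of the spectrum at a given
  root of unity.\<close>

definition damping :: "nat \<Rightarrow> nat \<Rightarrow> nat \<Rightarrow> nat \<Rightarrow> real" where
  "damping N M L k = window (real L * norm (unity_root M k - 1)) + 2 * real L / real N"

definition correction_weight :: "real \<Rightarrow> nat \<Rightarrow> (int \<Rightarrow> complex) \<Rightarrow> nat \<Rightarrow> nat \<Rightarrow> nat \<Rightarrow> real" where
  "correction_weight lam N c M L k =
     phase_const lam * cutoff_const lam * (spectral_weight c M k * damping N M L k)"

text \<open>The majorant is translated to each root of unity and weighted in proportion to spectral weight times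
  damping.  Its coefficients are carried by \<open>\<bar>n\<bar> < N\<close>.\<close>

definition correction :: "real \<Rightarrow> nat \<Rightarrow> (int \<Rightarrow> complex) \<Rightarrow> nat \<Rightarrow> nat \<Rightarrow> int \<Rightarrow> complex" where
  "correction lam N c M L n = (\<Sum>k<M. of_real (correction_weight lam N c M L k) *
      (inverse (unity_root M k) powi n * majorant_seq N n))"

lemma finite_support_correction: "finite {n. correction lam N c M L n \<noteq> 0}"
  unfolding correction_def
  by (intro finite_support_sum finite_support_mult finite_support_majorant_seq) simp

lemma symbol_correction:
  assumes "norm z = 1"
  shows "symbol (correction lam N c M L) z =
     of_real (\<Sum>k<M. correction_weight lam N c M L k * majorant N (z / unity_root M k))"
proof -
  have nz: "inverse (unity_root M k) \<noteq> 0" for k by (simp add: unity_root_def)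
  have u: "norm (z / unity_root M k) = 1" for k using assms by (simp add: norm_divide)
  have "symbol (correction lam N c M L) z = (\<Sum>k<M. of_real (correction_weight lam N c M L k) *
     symbol (majorant_seq N) (inverse (unity_root M k) * z))"
    unfolding correction_def
    by (subst symbol_sum) (simp_all only: finite_support_mult finite_support_majorant_seq
        finite_lessThan symbol_cmult symbol_modulate[OF nz])
  also have "\<dots> = (\<Sum>k<M. of_real (correction_weight lam N c M L k * majorant N (z / unity_root M k)))"
    using symbol_majorant_seq[OF u]
    by (intro sum.cong refl) (simp add: divide_inverse mult.commute)
  finally show ?thesis by simp
qed

text \<open>For each root of unity \<open>w\<close> the kernel bound provides the factor \<open>1 / (1 + N \<bar>z - w\<bar>)\<close>, which turns the
  window at \<open>z\<close> into the damping at \<open>w\<close>.\<close>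

lemma correction_dominates:
  assumes lam: "lam > 2" and N: "0 < N" and c: "turan_sequence (A_set N lam) c"
    and M: "separates M N lam" and z: "norm z = 1" and L: "0 < L" and s: "real s \<le> (lam + 1) * real L"
  shows "fejer L z * (2 * norm (z ^ s - 1)) * norm (symbol (right_part N c) z)
    \<le> Re (symbol (correction lam N c M L) z)"
proof -
  define q where "q = fejer L z * (2 * norm (z ^ s - 1))"
  have q0: "0 \<le> q" by (simp add: q_def fejer_def)
  have k0: "0 \<le> phase_const lam" using lam by (simp add: phase_const_def)
  have "q * norm (symbol (right_part N c) z) \<le> q * (\<Sum>k<M. spectral_weight c M k *
      (cutoff_const lam * majorant N (z / unity_root M k) / (1 + real N * norm (z - unity_root M k))))"
    by (intro mult_left_mono norm_symbol_right_part[OF lam N c M z] q0)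
  also have "\<dots> = (\<Sum>k<M. spectral_weight c M k * cutoff_const lam * majorant N (z / unity_root M k) *
      (q / (1 + real N * norm (z - unity_root M k))))"
    by (simp add: sum_distrib_left mult_ac)
  also have "\<dots> \<le> (\<Sum>k<M. spectral_weight c M k * cutoff_const lam * majorant N (z / unity_root M k) *
      (phase_const lam * damping N M L k))"
  proof (rule sum_mono)
    fix k
    define t where "t = 1 + real N * norm (z - unity_root M k)"
    have t: "0 < t" by (simp add: t_def add_pos_nonneg)
    have "q \<le> phase_const lam * window (real L * norm (z - 1))"
      unfolding q_def phase_const_def by (rule fejer_phase_bound[OF L s z])
    also have "\<dots> \<le> phase_const lam * (damping N M L k * t)"
      unfolding damping_def t_def by (intro mult_left_mono window_shift[OF N] k0)
    finally have "q / t \<le> phase_const lam * damping N M L k"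
      using t by (simp add: pos_divide_le_eq mult.assoc)
    then show "spectral_weight c M k * cutoff_const lam * majorant N (z / unity_root M k) *
        (q / (1 + real N * norm (z - unity_root M k)))
      \<le> spectral_weight c M k * cutoff_const lam * majorant N (z / unity_root M k) *
        (phase_const lam * damping N M L k)"
      unfolding t_def[symmetric]
      by (intro mult_left_mono mult_nonneg_nonneg spectral_weight_nonneg[OF c]
          cutoff_const_nonneg[OF lam] majorant_nonneg)
  qed
  also have "\<dots> = Re (symbol (correction lam N c M L) z)"
    unfolding symbol_correction[OF z] Re_complex_of_real correction_weight_def
    by (rule sum.cong[OF refl]) (simp only: mult_ac)
  finally show ?thesis by (simp add: q_def)
qed

lemma correction_0:
  assumes "0 < N"
  shows "correction lam N c M L 0 = of_real (2 * (\<Sum>k<M. correction_weight lam N c M L k))"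
  using assms by (simp add: correction_def majorant_seq_0 sum_distrib_left mult.commute)

lemma correction_eq_0: "int N \<le> \<bar>n\<bar> \<Longrightarrow> correction lam N c M L n = 0"
  by (simp add: correction_def majorant_seq_eq_0)

section \<open>Comparison of the two constants\<close>

lemma fejer_at_1: "0 < L \<Longrightarrow> fejer L 1 = 1"
  by (simp add: fejer_def dirichlet_def)

lemma right_part_nonzero:
  assumes lam: "lam > 2" and N: "0 < N" and c: "turan_sequence (A_set N lam) c"
    and n: "right_part N c n \<noteq> 0"
  shows "\<bar>of_int n - real N * lam\<bar> \<le> real N - 1"
proof -
  have "int N \<le> n" "c n \<noteq> 0" using n by (auto simp: right_part_def split: if_splits)
  then have "n \<in> A_set N lam" using c unfolding turan_sequence_def by metis
  then show ?thesis using A_set_cases[OF lam, of n N] \<open>int N \<le> n\<close> N by auto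
qed

text \<open>The outer blocks are translated outwards by \<open>s\<close>, the result is smoothed at scale \<open>L\<close>, and the correction
  is added.  Nonnegativity of the new symbol is \<open>correction_dominates\<close>.  At \<open>z = 1\<close> the translation
  has no effect, and the smoothed part of the coefficient at \<open>0\<close> is an average of coefficients of
  \<open>c\<close>, all of modulus at most \<open>1\<close>.\<close>

lemma perturbed_sequence:
  assumes lam: "lam > 2" and N: "0 < N" and c: "turan_sequence (A_set N lam) c"
    and M: "separates M N lam" and L: "0 < L" "L \<le> N" and s: "real s \<le> (lam + 1) * real L"
  obtains e where "positive_definite_int e" "finite {n. e n \<noteq> 0}"
    "Re (symbol c 1) \<le> Re (symbol e 1)"
    "Re (e 0) \<le> 1 + 2 * (\<Sum>k<M. correction_weight lam N c M L k)"
    "\<forall>n. e n \<noteq> 0 \<longrightarrow> \<bar>of_int n\<bar> \<le> real N + real L - 2 \<or>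
       \<bar>of_int n - (real N * lam + real s)\<bar> \<le> real N + real L - 2 \<or>
       \<bar>of_int n + (real N * lam + real s)\<bar> \<le> real N + real L - 2"
proof -
  have pd: "positive_definite_int c" and c0: "c 0 = 1" using c by (simp_all add: turan_sequence_def)
  have finc: "finite {n. c n \<noteq> 0}" by (rule turan_sequence_finite_support[OF c])
  define mid where "mid n = (if \<bar>n\<bar> < int N then c n else 0)" for n
  define h where "h = right_part N c"
  define h' where "h' n = h (n - int s)" for n
  define d where "d n = mid n + (h' n + cnj (h' (- n)))" for n
  define e where "e n = smooth L d n + correction lam N c M L n" for n
  have fin_mid: "finite {n. mid n \<noteq> 0}" and fin_h: "finite {n. h n \<noteq> 0}"
    by (auto intro!: finite_subset[OF _ finc] simp: mid_def h_def right_part_def)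
  have fin_h': "finite {n. h' n \<noteq> 0}" unfolding h'_def by (rule finite_support_shift[OF fin_h])
  have fin_reflect: "finite {n. cnj (g (- n)) \<noteq> 0}" if "finite {n. g n \<noteq> (0::complex)}" for g :: "int \<Rightarrow> complex"
    using finite_vimageI[OF that, of uminus] by (simp add: inj_on_def vimage_def)
  have fin_d: "finite {n. d n \<noteq> 0}"
    unfolding d_def by (intro finite_support_add fin_mid fin_h' fin_reflect)
  have fin_e: "finite {n. e n \<noteq> 0}"
    unfolding e_def by (intro finite_support_add finite_support_smooth fin_d finite_support_correction)
  \<comment> \<open>Hermitian symmetry: the left block is the conjugate reflection of the right one.\<close>
  have c_split: "c = (\<lambda>n. mid n + (h n + cnj (h (- n))))"
    using N pd_int_hermitian[OF pd] by (auto simp: fun_eq_iff mid_def h_def right_part_def)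
  have sym_d: "symbol d z = of_real (Re (symbol c z) + 2 * Re ((z ^ s - 1) * symbol h z))" if z: "norm z = 1" for z
  proof -
    have z0: "z \<noteq> 0" using z by auto
    have "symbol d z = symbol mid z + (z ^ s * symbol h z + cnj (z ^ s * symbol h z))"
      unfolding d_def symbol_add[OF fin_mid finite_support_add[OF fin_h' fin_reflect[OF fin_h']]]
        symbol_add[OF fin_h' fin_reflect[OF fin_h']] symbol_reflect[OF z]
      by (simp add: h'_def[abs_def] symbol_shift[OF z0])
    moreover have "symbol c z = symbol mid z + (symbol h z + cnj (symbol h z))"
      unfolding symbol_add[OF fin_h fin_reflect[OF fin_h], symmetric] symbol_reflect[OF z, symmetric]
        symbol_add[OF fin_mid finite_support_add[OF fin_h fin_reflect[OF fin_h]], symmetric]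
      by (subst c_split) (rule refl)
    ultimately have "symbol d z = symbol c z + ((z ^ s - 1) * symbol h z + cnj ((z ^ s - 1) * symbol h z))"
      by (simp add: algebra_simps)
    also have "\<dots> = of_real (Re (symbol c z)) + of_real (2 * Re ((z ^ s - 1) * symbol h z))"
      by (simp only: complex_add_cnj turan_sequence_symbol(1)[OF c z, symmetric])
    finally show ?thesis by simp
  qed
  define K where "K z = Re (symbol (correction lam N c M L) z)" for z
  have sym_e: "symbol e z = of_real (fejer L z * (Re (symbol c z) + 2 * Re ((z ^ s - 1) * symbol h z)) + K z)"
    if z: "norm z = 1" for z
  proof -
    have "symbol (correction lam N c M L) z = of_real (K z)"
      unfolding K_def symbol_correction[OF z] by simp
    then show ?thesis
      unfolding e_def
      by (subst symbol_add)
        (simp_all add: finite_support_smooth fin_d finite_support_correction symbol_smooth[OF z fin_d] sym_d[OF z])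
  qed
  have dom: "fejer L z * (2 * norm (z ^ s - 1)) * norm (symbol h z) \<le> K z" if "norm z = 1" for z
    unfolding K_def h_def by (rule correction_dominates[OF lam N c M that L(1) s])
  have pos: "0 \<le> fejer L z * (Re (symbol c z) + 2 * Re ((z ^ s - 1) * symbol h z)) + K z"
    if z: "norm z = 1" for z
  proof -
    have f: "0 \<le> fejer L z" by (simp add: fejer_def)
    have "- norm ((z ^ s - 1) * symbol h z) \<le> Re ((z ^ s - 1) * symbol h z)"
      using abs_Re_le_cmod[of "(z ^ s - 1) * symbol h z"] by linarith
    then have "- (2 * (norm (z ^ s - 1) * norm (symbol h z)))
       \<le> Re (symbol c z) + 2 * Re ((z ^ s - 1) * symbol h z)"
      using turan_sequence_symbol(2)[OF c z] unfolding norm_mult by linarith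
    then have "fejer L z * (- (2 * (norm (z ^ s - 1) * norm (symbol h z))))
       \<le> fejer L z * (Re (symbol c z) + 2 * Re ((z ^ s - 1) * symbol h z))"
      using f by (rule mult_left_mono)
    moreover have "fejer L z * (- (2 * (norm (z ^ s - 1) * norm (symbol h z))))
       = - (fejer L z * (2 * norm (z ^ s - 1)) * norm (symbol h z))"
      by (simp add: mult_ac)
    ultimately show ?thesis using dom[OF z] by linarith
  qed
  have "positive_definite_int e"
  proof (rule pd_int_of_symbol[OF fin_e])
    show "symbol e z \<in> \<real>\<^sub>\<ge>\<^sub>0" if "norm z = 1" for z
      unfolding sym_e[OF that] nonneg_Reals_of_real_iff by (rule pos[OF that])
  qed
  moreover have "Re (symbol c 1) \<le> Re (symbol e 1)"
    using dom[of 1] L by (subst sym_e) (simp_all add: fejer_at_1)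
  moreover have "Re (e 0) \<le> 1 + 2 * (\<Sum>k<M. correction_weight lam N c M L k)"
  proof -
    have "norm (smooth L d 0) \<le> 1"
    proof (rule norm_smooth_le[OF L(1)])
      fix m :: int assume "\<bar>0 - m\<bar> < int L"
      then have "\<bar>m\<bar> < int N" "\<not> int N \<le> m - int s" "\<not> int N \<le> - m - int s"
        using L(2) by linarith+
      then have "d m = c m" by (simp add: d_def mid_def h'_def h_def right_part_def)
      then show "norm (d m) \<le> 1" using turan_sequence_bound[OF c] by simp
    qed
    then have "Re (smooth L d 0) \<le> 1" using complex_Re_le_cmod order_trans by blast
    then show ?thesis by (simp add: e_def correction_0[OF N])
  qed
  moreover have "\<bar>of_int n\<bar> \<le> real N + real L - 2 \<or>
       \<bar>of_int n - (real N * lam + real s)\<bar> \<le> real N + real L - 2 \<or>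
       \<bar>of_int n + (real N * lam + real s)\<bar> \<le> real N + real L - 2" if "e n \<noteq> 0" for n
  proof (cases "smooth L d n = 0")
    case True
    then have "correction lam N c M L n \<noteq> 0" using that by (simp add: e_def)
    then have "\<bar>n\<bar> < int N" using correction_eq_0 not_le by blast
    then show ?thesis using L by linarith
  next
    case False
    then obtain m where m: "d m \<noteq> 0" "\<bar>n - m\<bar> \<le> int L - 1" by (rule smooth_nonzero)
    have "mid m \<noteq> 0 \<or> h (m - int s) \<noteq> 0 \<or> h (- m - int s) \<noteq> 0"
      by (rule ccontr) (use m(1) in \<open>simp add: d_def h'_def\<close>)
    then consider "mid m \<noteq> 0" | "h (m - int s) \<noteq> 0" | "h (- m - int s) \<noteq> 0"
      by metis
    then show ?thesis
    proof cases
      case 1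
      then have "\<bar>m\<bar> < int N" by (simp add: mid_def split: if_splits)
      then show ?thesis using m(2) by linarith
    next
      case 2
      then have "\<bar>of_int (m - int s) - real N * lam\<bar> \<le> real N - 1"
        unfolding h_def by (rule right_part_nonzero[OF lam N c])
      then show ?thesis using m(2) by linarith
    next
      case 3
      then have "\<bar>of_int (- m - int s) - real N * lam\<bar> \<le> real N - 1"
        unfolding h_def by (rule right_part_nonzero[OF lam N c])
      then show ?thesis using m(2) by linarith
    qed
  qed
  ultimately show ?thesis using fin_e by (intro that) auto
qed

text \<open>Interpolating at mesh width \<open>1 / (N + s / lam)\<close> puts the centres of the outer blocks at \<open>\<plusminus>lam\<close> exactly.
  The half-width of the blocks after interpolation is \<open>N + L - 1\<close> units, less than \<open>N + s / lam\<close>, so the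
  closed support lies in the open set.\<close>

lemma turan_real_lower:
  assumes lam: "lam > 2" and N: "0 < N" and L: "0 < L" and s: "lam * real L \<le> real s"
    and pd: "positive_definite_int e" and fin: "finite {n. e n \<noteq> 0}"
    and \<kappa>: "Re (e 0) \<le> \<kappa>" "0 < \<kappa>"
    and supp: "\<And>n. e n \<noteq> 0 \<Longrightarrow> \<bar>of_int n\<bar> \<le> real N + real L - 2 \<or>
       \<bar>of_int n - (real N * lam + real s)\<bar> \<le> real N + real L - 2 \<or>
       \<bar>of_int n + (real N * lam + real s)\<bar> \<le> real N + real L - 2"
  shows "Re (symbol e 1) \<le> (real N + real s / lam) * \<kappa> * turan_real (Omega lam)"
proof -
  define R where "R = real N + real s / lam"
  define r where "r = (real N + real L - 1) / R"
  have R: "0 < R" using lam N by (simp add: R_def add_pos_nonneg)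
  have Rlam: "R * lam = real N * lam + real s" using lam by (simp add: R_def distrib_right)
  have "real L \<le> real s / lam" using s lam by (simp add: pos_le_divide_eq mult.commute)
  then have r1: "r < 1" using R by (simp add: r_def R_def)
  \<comment> \<open>A multiple of the impulse raises the coefficient at \<open>0\<close> to exactly \<open>\<kappa>\<close> before normalising; this
    covers the case of a vanishing \<open>e 0\<close>.\<close>
  define e' where "e' n = of_real (1 / \<kappa>) * (e n + of_real (\<kappa> - Re (e 0)) * impulse 0 n)" for n
  define f where "f x = interp e' (R * x)" for x
  have fin': "finite {n. e' n \<noteq> 0}"
    unfolding e'_def by (intro finite_support_mult finite_support_add fin finite_support_impulse)
  have pd': "positive_definite_int e'"
    unfolding e'_def using \<kappa> by (intro pd_int_scale pd_int_add pd pd_int_impulse) auto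
  have "e 0 = of_real (Re (e 0))"
    using pd_int_diag[OF pd] by (simp add: complex_nonneg_Reals_iff complex_eq_iff)
  then have e'0: "e' 0 = 1" using \<kappa>(2) by (simp add: e'_def impulse_def flip: of_real_add)
  have supp_f: "x \<in> {-r..r} \<union> {lam - r..lam + r} \<union> {-lam - r..-lam + r}" if "f x \<noteq> 0" for x
  proof -
    have "interp e' (R * x) \<noteq> 0" using that by (simp add: f_def)
    then obtain n where n: "e' n \<noteq> 0" "\<bar>R * x - of_int n\<bar> < 1"
      by (rule interp_nonzero)
    have near: "\<bar>x - t\<bar> \<le> r" if "\<bar>of_int n - R * t\<bar> \<le> real N + real L - 2" for t
    proof -
      have "R * \<bar>x - t\<bar> = \<bar>R * x - R * t\<bar>" using R by (simp add: abs_mult flip: right_diff_distrib)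
      also have "\<dots> \<le> real N + real L - 1" using n(2) that by linarith
      finally show ?thesis using R by (simp add: r_def pos_le_divide_eq mult.commute)
    qed
    have "n = 0 \<or> e n \<noteq> 0" using n(1) by (auto simp: e'_def impulse_def split: if_splits)
    then have "\<bar>of_int n\<bar> \<le> real N + real L - 2 \<or> \<bar>of_int n - R * lam\<bar> \<le> real N + real L - 2 \<or>
       \<bar>of_int n + R * lam\<bar> \<le> real N + real L - 2"
      using supp[of n] N L unfolding Rlam by auto
    then show ?thesis using near[of 0] near[of lam] near[of "- lam"] by (auto simp: abs_le_iff)
  qed
  have "turan_function (Omega lam) f"
    unfolding turan_function_def
  proof (intro conjI)
    show "continuous_on UNIV f" unfolding f_def
      by (rule continuous_on_compose2[OF continuous_on_interp]) (auto intro!: continuous_intros)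
    show "positive_definite_real f" unfolding f_def
      by (intro pd_real_scale_argument pd_real_interp pd' fin')
    show "f 0 = 1" by (simp add: f_def interp_0 fin' e'0)
    have "closed_support f \<subseteq> {-r..r} \<union> {lam - r..lam + r} \<union> {-lam - r..-lam + r}"
      unfolding closed_support_def
    proof (rule closure_minimal)
      show "{x. f x \<noteq> 0} \<subseteq> {-r..r} \<union> {lam - r..lam + r} \<union> {-lam - r..-lam + r}"
        by (intro subsetI supp_f) simp
    qed (intro closed_Un closed_atLeastAtMost)
    also have "\<dots> \<subseteq> Omega lam" using r1 by (auto simp: Omega_def)
    finally show "closed_support f \<subseteq> Omega lam" .
  qed
  then have "Re (LINT x|lborel. f x) \<le> turan_real (Omega lam)" by (rule turan_real_upper)
  moreover have "(LINT x|lborel. f x) = symbol e' 1 / of_real R"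
    using has_bochner_integral_interp[OF R, of e'] by (simp add: f_def has_bochner_integral_iff)
  moreover have "symbol e' 1 = of_real (1 / \<kappa>) * (symbol e 1 + of_real (\<kappa> - Re (e 0)))"
    unfolding e'_def symbol_cmult
    by (subst symbol_add) (simp_all only: fin finite_support_mult finite_support_impulse symbol_cmult symbol_impulse
        power_int_1_left mult_1_right)
  ultimately have "(Re (symbol e 1) + (\<kappa> - Re (e 0))) / \<kappa> / R \<le> turan_real (Omega lam)"
    by simp
  then have "Re (symbol e 1) + (\<kappa> - Re (e 0)) \<le> R * \<kappa> * turan_real (Omega lam)"
    using R \<kappa>(2) by (simp add: pos_divide_le_eq mult_ac)
  then show ?thesis using \<kappa>(1) by (simp add: R_def)
qed

lemma turan_real_nonneg: "0 \<le> turan_real (Omega lam)"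
proof -
  have "(LINT x|lborel. interp (impulse 0) (2 * x)) = of_real (1 / 2)"
    using has_bochner_integral_interp[of 2 "impulse 0"]
    by (simp add: has_bochner_integral_iff symbol_impulse)
  then have "Re (of_real (1 / 2)) \<le> turan_real (Omega lam)"
    using turan_real_upper[OF turan_function_exists, of lam] by (simp only:)
  then show ?thesis by simp
qed

text \<open>The dampings at the dyadic scales below \<open>J\<close> add up to at most \<open>3\<close> at every root of unity: the windows
  telescope and the remainders form a geometric series.  By averaging, one scale contributes at most
  \<open>3 / J\<close>.\<close>

lemma exists_good_scale:
  assumes N: "2 ^ J \<le> real N" and J: "0 < J"
    and c: "turan_sequence (A_set N lam) c" and M: "separates M N lam"
  obtains j where "j < J" "(\<Sum>k<M. spectral_weight c M k * damping N M (2 ^ j) k) \<le> 3 / real J"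
proof -
  define \<mu> where "\<mu> j = (\<Sum>k<M. spectral_weight c M k * damping N M (2 ^ j) k)" for j
  have N0: "0 < real N" using N less_le_trans[of 0 "2 ^ J" "real N"] by simp
  have damp: "(\<Sum>j<J. damping N M (2 ^ j) k) \<le> 3" for k
  proof -
    have "(\<Sum>j<J. 2 ^ j) = (2 ^ J - 1 :: real)"
      using geometric_sum[of "2 :: real" J] by simp
    then have "(\<Sum>j<J. 2 * 2 ^ j / real N) = 2 * (2 ^ J - 1) / real N"
      by (simp flip: sum_divide_distrib sum_distrib_left)
    also have "\<dots> \<le> 2"
      unfolding pos_divide_le_eq[OF N0] using N by (intro mult_left_mono) (linarith, simp)
    finally show ?thesis
      using sum_window_dyadic[of "norm (unity_root M k - 1)" J] by (simp add: damping_def sum.distrib)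
  qed
  have "(\<Sum>j<J. \<mu> j) = (\<Sum>k<M. spectral_weight c M k * (\<Sum>j<J. damping N M (2 ^ j) k))"
    unfolding \<mu>_def sum_distrib_left by (rule sum.swap)
  also have "\<dots> \<le> (\<Sum>k<M. spectral_weight c M k * 3)"
    by (intro sum_mono mult_left_mono damp spectral_weight_nonneg[OF c])
  also have "\<dots> = 3" by (simp add: sum_spectral_weight[OF c M] flip: sum_distrib_right)
  finally have total: "(\<Sum>j<J. \<mu> j) \<le> 3" .
  have "\<exists>j<J. \<mu> j \<le> 3 / real J"
  proof (rule ccontr)
    assume "\<not> (\<exists>j<J. \<mu> j \<le> 3 / real J)"
    then have "(\<Sum>j<J. 3 / real J) < (\<Sum>j<J. \<mu> j)"
      using J by (intro sum_strict_mono) auto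
    with total J show False by simp
  qed
  then show ?thesis using that by (auto simp: \<mu>_def)
qed

definition loss_const :: "real \<Rightarrow> real" where
  "loss_const lam = 6 * phase_const lam * cutoff_const lam"

lemma loss_const_nonneg: "lam > 2 \<Longrightarrow> 0 \<le> loss_const lam"
  by (simp add: loss_const_def phase_const_def cutoff_const_nonneg)

text \<open>The factor \<open>1 + loss_const lam / J\<close> accounts for the growth of the coefficient at \<open>0\<close>, the factor
  \<open>1 + 2 * 2 ^ J / N\<close> for the finer mesh.\<close>

lemma turan_int_le_turan_real:
  assumes lam: "lam > 2" and J: "0 < J" and N: "2 ^ J \<le> real N"
  shows "(1 / real N) * turan_int (A_set N lam)
    \<le> (1 + 2 * 2 ^ J / real N) * ((1 + loss_const lam / real J) * turan_real (Omega lam))"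
proof -
  define T where "T = turan_real (Omega lam)"
  define \<kappa> where "\<kappa> = 1 + loss_const lam / real J"
  have T: "0 \<le> T" by (simp add: T_def turan_real_nonneg)
  have \<kappa>: "0 < \<kappa>" using loss_const_nonneg[OF lam] by (simp add: \<kappa>_def add_pos_nonneg)
  have N0: "0 < N" using N less_le_trans[of 0 "2 ^ J" "real N"] by simp
  have "turan_int (A_set N lam) \<le> (real N + 2 * 2 ^ J) * (\<kappa> * T)"
  proof (rule turan_int_least)
    show "0 \<in> A_set N lam" using N0 by (simp add: A_set_def)
    fix c assume c: "turan_sequence (A_set N lam) c"
    obtain M where M: "separates M N lam" by (rule separates_exists)
    obtain j where j: "j < J" "(\<Sum>k<M. spectral_weight c M k * damping N M (2 ^ j) k) \<le> 3 / real J"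
      by (rule exists_good_scale[OF N J c M])
    define L :: nat where "L = 2 ^ j"
    \<comment> \<open>An integer translation that makes room for smoothing at scale \<open>L\<close> after rescaling.\<close>
    define s where "s = nat \<lceil>lam * real L\<rceil>"
    have LJ: "real L \<le> 2 ^ J" using j(1) by (simp add: L_def)
    have "real L \<le> real N" using LJ N by linarith
    then have L: "0 < L" "L \<le> N" by (simp_all only: of_nat_le_iff) (simp add: L_def)
    have lamL: "0 \<le> lam * real L" using lam by simp
    have s_ge: "lam * real L \<le> real s" unfolding s_def by linarith
    have "real s \<le> lam * real L + 1" unfolding s_def using lamL by linarith
    also have "\<dots> \<le> (lam + 1) * real L" using L(1) by (simp add: distrib_right)
    finally have s_le: "real s \<le> (lam + 1) * real L" .
    obtain e where e: "positive_definite_int e" "finite {n. e n \<noteq> 0}"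
      "Re (symbol c 1) \<le> Re (symbol e 1)"
      "Re (e 0) \<le> 1 + 2 * (\<Sum>k<M. correction_weight lam N c M L k)"
      "\<forall>n. e n \<noteq> 0 \<longrightarrow> \<bar>of_int n\<bar> \<le> real N + real L - 2 \<or>
         \<bar>of_int n - (real N * lam + real s)\<bar> \<le> real N + real L - 2 \<or>
         \<bar>of_int n + (real N * lam + real s)\<bar> \<le> real N + real L - 2"
      by (rule perturbed_sequence[OF lam N0 c M L s_le])
    have pc: "0 \<le> phase_const lam * cutoff_const lam"
      using lam by (simp add: phase_const_def cutoff_const_nonneg)
    have "(\<Sum>k<M. correction_weight lam N c M L k)
        = phase_const lam * cutoff_const lam * (\<Sum>k<M. spectral_weight c M k * damping N M L k)"
      by (simp add: correction_weight_def sum_distrib_left)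
    also have "\<dots> \<le> phase_const lam * cutoff_const lam * (3 / real J)"
      using j(2) pc unfolding L_def by (rule mult_left_mono)
    finally have "Re (e 0) \<le> \<kappa>" using e(4) by (simp add: \<kappa>_def loss_const_def)
    then have "Re (symbol e 1) \<le> (real N + real s / lam) * \<kappa> * T"
      unfolding T_def by (intro turan_real_lower[OF lam N0 L(1) s_ge e(1,2) _ \<kappa> e(5)[rule_format]])
    moreover have "real s / lam \<le> 2 * 2 ^ J"
    proof -
      have "real s \<le> (2 * lam) * real L"
        using s_le lam mult_right_mono[of "lam + 1" "2 * lam" "real L"] by linarith
      then have "real s / lam \<le> 2 * real L" using lam by (simp add: pos_divide_le_eq mult_ac)
      then show ?thesis using LJ by linarith
    qed
    then have "(real N + real s / lam) * (\<kappa> * T) \<le> (real N + 2 * 2 ^ J) * (\<kappa> * T)"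
      using \<kappa> T by (intro mult_right_mono) auto
    moreover have "(\<Sum>n\<in>A_set N lam. c n) = symbol c 1"
      using c by (subst symbol_eq_sum[OF finite_A_set[of N lam]]) (auto simp: turan_sequence_def)
    ultimately show "Re (\<Sum>n\<in>A_set N lam. c n) \<le> (real N + 2 * 2 ^ J) * (\<kappa> * T)"
      using e(3) by (simp only: mult.assoc)
  qed
  then have "(1 / real N) * turan_int (A_set N lam) \<le> (1 / real N) * ((real N + 2 * 2 ^ J) * (\<kappa> * T))"
    by (rule mult_left_mono) simp
  also have "\<dots> = (1 + 2 * 2 ^ J / real N) * (\<kappa> * T)" using N0 by (simp add: field_simps)
  finally show ?thesis by (simp only: \<kappa>_def T_def)
qed

theorem theorem1p3:
  fixes lam :: real
  assumes "lam > 2"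
  shows "(\<lambda>N::nat. (1 / real N) * turan_int (A_set N lam)) \<longlonglongrightarrow> turan_real (Omega lam)"
proof (rule order_tendstoI)
  fix y assume "y < turan_real (Omega lam)"
  then obtain f where "turan_function (Omega lam) f" "y < Re (LINT x|lborel. f x)"
    by (rule turan_real_approx)
  then show "\<forall>\<^sub>F N in sequentially. y < (1 / real N) * turan_int (A_set N lam)"
    by (rule turan_int_above_integral)
next
  fix y assume y: "turan_real (Omega lam) < y"
  define b where "b J = (1 + loss_const lam / real J) * turan_real (Omega lam)" for J :: nat
  have "b \<longlonglongrightarrow> (1 + 0) * turan_real (Omega lam)"
    unfolding b_def by (intro tendsto_intros lim_const_over_n)
  then have "\<forall>\<^sub>F J in sequentially. b J < y" using y by (intro order_tendstoD) auto
  then have "\<forall>\<^sub>F J in sequentially. b J < y \<and> 0 < J"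
    using eventually_gt_at_top[of 0] by (rule eventually_conj)
  then obtain J where J: "b J < y" "0 < J" by (auto simp: eventually_sequentially)
  have "(\<lambda>N. (1 + 2 * 2 ^ J / real N) * b J) \<longlonglongrightarrow> (1 + 0) * b J"
    by (intro tendsto_intros lim_const_over_n)
  then have "\<forall>\<^sub>F N in sequentially. (1 + 2 * 2 ^ J / real N) * b J < y"
    using J(1) by (intro order_tendstoD) auto
  moreover have "\<forall>\<^sub>F N in sequentially. 2 ^ J \<le> real N"
    using eventually_ge_at_top[of "2 ^ J"] by eventually_elim (metis of_nat_le_iff of_nat_numeral of_nat_power)
  ultimately show "\<forall>\<^sub>F N in sequentially. (1 / real N) * turan_int (A_set N lam) < y"
  proof eventually_elim
    case (elim N)
    then show ?case
      using turan_int_le_turan_real[OF assms J(2) elim(2)] unfolding b_def by linarith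
  qed
qed

end
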